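(* Let $\Pi$ be a protocol run by the parties in $\mathbb{P}$ in $N$ rounds, with block-proportional rewards with $R$ rewards per block, where each party's stake is $\mathcal{S}_P=\mu_P\cdot\mathcal{S}$. Let $\alpha$ be a security threshold w.r.t. an infraction predicate $\mathsf{IP}$. Assume that for every strategy profile $\sigma$ the exchange rate $X_\sigma$ w.r.t. $\mathsf{IP},\alpha$ is $$X_\sigma(\Im)=\begin{cases}x_{\max},&\text{if }\sum_{P\in\mathbb{P}:\mathsf{IP}(\Im,P)=1}\mu_P<\alpha\\ x_{\min},&\text{otherwise,}\end{cases}$$ and the external rewards due to guided bribing w.r.t. $\mathsf{IP}$ are $B_{P,\sigma}(\Im)=\beta_P$ if $\mathsf{IP}(\Im,P)=1$ and $B_{P,\sigma}(\Im)=0$ otherwise. Let $x=x_{\max}-x_{\min}$. Then, for the utility Reward under $\mathcal{R}_{\text{sync}}$: 1. If for every party $P\in\mathbb{P}$ it holds that $\mu_P\le1-\alpha$, and $\sum_{P\in\mathbb{P}}\beta_P$ is a non-negligible value upper bounded by $\alpha\cdot(N\cdot R+\mathcal{S})\cdot x$, then the Price of Anarchy is bounded by $$\frac{1}{\alpha+(1-\alpha)\cdot\frac{x_{\min}}{x_{\max}}}-\mathrm{negl}(\kappa)\le\mathsf{PAn}<\infty.$$ 2. If for every party $P\in\mathbb{P}$ it holds that $\mu_P<\alpha$, and $\sum_{P\in\mathbb{P}}\beta_P=\mathrm{negl}(\kappa)$, then $\mathsf{PAn}\ge\Big(1+\frac{N\cdot R}{\mathcal{S}}\Big)\cdot\f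rac{x_{\max}}{x_{\min}}$.
   Context: Model. $\kappa$ is the security parameter; $\mathrm{negl}(\kappa)$ denotes a negligible function of $\kappa$. A Proof-of-Stake ledger protocol $\Pi$ is run by a finite set $\mathbb{P}$ of $n$ rational parties over $N$ time slots (rounds), $N$ polynomial in $\kappa$. Party $P$ holds a fraction $\mu_P\in[0,1]$ of the participation power, with $\sum_{P\in\mathbb{P}}\mu_P=1$. Before the execution each party picks a strategy from the set $\mathbb{S}$ of all efficient algorithms; a strategy profile $\sigma$ is the vector of all parties' strategies. $\Pi$ also denotes the honest strategy (following the protocol), and $\sigma_\Pi=\langle\Pi,\dots,\Pi\rangle$. An execution under $\sigma$ is a random process; a trace $\Im$ is its outcome for a fixed environment (which schedules activations and provides inputs), router, profile, and random coins. The synchronous router $\mathcal{R}_{\text{sync}}$ delivers every message at the end of the round in which it was created. Ledger and rewards. In each slot a leader and a committee of parties are elected; the leader may propose a block, committee members sign it if valid, and a party appends a block to its chain when it has signatures of committee members whose aggregate power exceeds a protocol-defined threshold (typically $2/3$ of the committee's power). At the end of the execution a passive, always-online observer outputs a chain. Block-proportional rewards with $R$ rewards per block: the ledger rewards of $P$ are $R_{P,\sigma}(\Im)=M_{P,\Im}\cdot R$, where $M_{P,\Im}$ is the number of blocks created by $P$ in the observer's chain. $M_{P,\sigma_\Pi}$ is the random number of blocks created by $P$ under $\sigma_\Pi$. Standing assumptions: under $\sigma_\Pi$ the total block rewards given by the system are maximized; exactly one block is created per slot; and for every $\theta\in(0,1)$, $\Pr[M_{P,\sigma_\Pi}\ge(1+\theta)E[M_{P,\sigma_\Pi}]]\le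 e^{-\frac{\theta^2}{3}E[M_{P,\sigma_\Pi}]}$ and $\Pr[M_{P,\sigma_\Pi}\le(1-\theta)E[M_{P,\sigma_\Pi}]]\le e^{-\frac{\theta^2}{2}E[M_{P,\sigma_\Pi}]}$. Infractions. An infraction predicate $\mathsf{IP}(\Im,P)\in\{0,1\}$ equals $1$ iff in $\Im$ party $P$ deviates from the protocol in a specified way within a time frame $\Delta$; it is always $0$ if $P$ follows $\Pi$. The infractions considered are safety infractions, in particular double signing (proposing or signing two blocks such that every chain containing both is invalid). The strategy $S_{\mathsf{IP}}$ performs the infraction whenever possible and behaves honestly otherwise. $\Delta$ is large enough that a party following $S_{\mathsf{IP}}$ fails to perform the infraction only with probability $\mathrm{negl}(\kappa)$. The security threshold $\alpha\in(0,1)$ is the power fraction such that, if parties with aggregate power at least $\alpha$ all follow $S_{\mathsf{IP}}$, the attack succeeds with probability $1-\mathrm{negl}(\kappa)$. Utility. $\mathcal{S}$ is the total stake, $\mathcal{S}_P=\mu_P\mathcal{S}$ the stake of $P$; $x_{\max}>x_{\min}\ge0$ are constants; the bribes $\beta_P\ge 0$ are real numbers. The utility Reward is $U_P(\sigma)=E[\mathcal{S}_P\cdot X_\sigma]+E[R_{P,\sigma}\cdot X_\sigma]+E[B_{P,\sigma}]$. Equilibrium and price of anarchy. A profile $\sigma^*=(S^*_i,S^*_{-i})$ is an $\epsilon$-Nash equilibrium if for every party $P_i$ and every $S_i\in\mathbb{S}\setminus\{S_i^*\}$: $U_{P_i}(S_i^*,S_{-i}^* )\ge U_{P_i}(S_i,S_{-i}^*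 )-\epsilon$. $\mathbb{EQ}$ is the set of all $\mathrm{negl}(\kappa)$-Nash equilibria. The welfare is $\mathsf{Welf}(\sigma)=\sum_{P\in\mathbb{P}}U_P(\sigma)$ and the Price of Anarchy is $\mathsf{PAn}=\dfrac{\max_{\sigma\in\mathbb{S}^n}\mathsf{Welf}(\sigma)}{\min_{\sigma\in\mathbb{EQ}}\mathsf{Welf}(\sigma)}$.
   Formalization: Item 2 is false as printed; it is proved assuming also that every μ_P ≤ 1−α and that, except with negligible probability, no single party's power exceeds a committee's signing threshold, and with x_min replaced by x_min + negl(κ) in the bound. *)

theory Defs
  imports "HOL-Probability.Probability"
begin

section \<open>Asymptotics in the security parameter\<close>

definition negl :: "(nat \<Rightarrow> real) \<Rightarrow> bool" where
  "negl f \<longleftrightarrow> (\<forall>c::nat. \<forall>\<^sub>F \<kappa> in sequentially. \<bar>f \<kappa>\<bar> < 1 / real \<kappa> ^ c)"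

definition poly_bounded :: "(nat \<Rightarrow> nat) \<Rightarrow> bool" where
  "poly_bounded f \<longleftrightarrow> (\<exists>c::nat. \<forall>\<^sub>F \<kappa> in sequentially. f \<kappa> \<le> \<kappa> ^ c)"

section \<open>Ledger protocols under the synchronous router\<close>

text \<open>Everything in this section is at one fixed security parameter; the finite set of parties is
  the finite type \<open>'p\<close>. A payload in \<open>'d\<close> stands for the whole content of a block, possibly
  including a reference to a predecessor.\<close>

datatype ('p, 'd) block = Block (bslot: nat) (creator: 'p) (payload: 'd)

text \<open>The log of a slot records the elected leader and committee and, for each party, the blocks
  which it proposed and the blocks which it signed in this slot. The trace of an execution is the
  list of all logs: \<open>tr ! t\<close> is the log of slot \<open>t\<close>.\<close>

record ('p, 'd) slot_log =
  leader :: 'p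
  committee :: "'p set"
  proposals :: "'p \<Rightarrow> ('p, 'd) block set"
  signatures :: "'p \<Rightarrow> ('p, 'd) block set"

type_synonym ('p, 'd) trace = "('p, 'd) slot_log list"

text \<open>A slot has a proposing step and a signing step. The synchronous router delivers all messages
  of a step to everybody at the end of that step. So a party that acts in slot \<open>length h\<close> knows its
  name, its private coins, the logs \<open>h\<close> of all earlier slots, and the current leader and committee;
  when signing it knows in addition the proposals of the current slot. The environment is fixed and
  hence part of the strategy functions. Messages are attributed to their senders, that is,
  signatures cannot be forged.\<close>

record ('p, 'd, 'c) strategy =
  propose :: "'p \<Rightarrow> 'c \<Rightarrow> ('p, 'd) trace \<Rightarrow> 'p \<Rightarrow> 'p set \<Rightarrow> ('p, 'd) block set"
  sign :: "'p \<Rightarrow> 'c \<Rightarrow> ('p, 'd) trace \<Rightarrow> 'p \<Rightarrow> 'p set \<Rightarrow> ('p \<Rightarrow> ('p, 'd) block set)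
             \<Rightarrow> ('p, 'd) block set"

type_synonym ('p, 'd, 'c) profile = "'p \<Rightarrow> ('p, 'd, 'c) strategy"

text \<open>\<open>elections\<close> is the distribution of the list of the leaders and committees of all slots,
  \<open>coins\<close> the distribution of the private coins of the parties, \<open>valid_ext C b\<close> says that
  block \<open>b\<close> may validly be appended to chain \<open>C\<close>, \<open>quorum C\<close> is the power which the signers of a
  block must exceed if \<open>C\<close> is the committee (typically two thirds of the power of \<open>C\<close>), and
  \<open>select\<close> is the tie-breaking rule.\<close>

record ('p, 'd, 'c) protocol =
  num_slots :: nat
  elections :: "('p \<times> 'p set) list pmf"
  coins :: "('p \<Rightarrow> 'c) pmf"
  valid_ext :: "('p, 'd) block list \<Rightarrow> ('p, 'd) block \<Rightarrow> bool"
  quorum :: "'p set \<Rightarrow> real"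
  select :: "('p, 'd) block set \<Rightarrow> ('p, 'd) block"
  honest :: "('p, 'd, 'c) strategy"

definition eligible ::
  "('p, 'd, 'c) protocol \<Rightarrow> ('p, 'd) block list \<Rightarrow> nat \<Rightarrow> 'p \<Rightarrow> ('p, 'd) block set
     \<Rightarrow> ('p, 'd) block set" where
  "eligible prot C t l A = {b \<in> A. bslot b = t \<and> creator b = l \<and> valid_ext prot C b}"

definition certified ::
  "('p::finite \<Rightarrow> real) \<Rightarrow> ('p, 'd, 'c) protocol \<Rightarrow> ('p, 'd) slot_log \<Rightarrow> ('p, 'd) block set" where
  "certified \<mu> prot s =
     {b. (\<Sum>P | P \<in> committee s \<and> b \<in> signatures s P. \<mu> P) > quorum prot (committee s)}"

definition append_slot ::
  "('p::finite \<Rightarrow> real) \<Rightarrow> ('p, 'd, 'c) protocol \<Rightarrow> ('p, 'd) block list \<Rightarrow> nat \<Rightarrow> ('p, 'd) slot_log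
     \<Rightarrow> ('p, 'd) block list" where
  "append_slot \<mu> prot C t s =
     (let Q = eligible prot C t (leader s) (proposals s (leader s)) \<inter> certified \<mu> prot s
      in if Q = {} then C else C @ [select prot Q])"

primrec chain_from ::
  "('p::finite \<Rightarrow> real) \<Rightarrow> ('p, 'd, 'c) protocol \<Rightarrow> ('p, 'd) block list \<Rightarrow> nat \<Rightarrow> ('p, 'd) trace
     \<Rightarrow> ('p, 'd) block list" where
  "chain_from \<mu> prot C t [] = C"
| "chain_from \<mu> prot C t (s # ss) = chain_from \<mu> prot (append_slot \<mu> prot C t s) (Suc t) ss"

text \<open>The chain of the passive always-online observer. Since every message reaches everybody, it is
  also the chain of every party that follows the protocol.\<close>

definition chain ::
  "('p::finite \<Rightarrow> real) \<Rightarrow> ('p, 'd, 'c) protocol \<Rightarrow> ('p, 'd) trace \<Rightarrow> ('p, 'd) block list" where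
  "chain \<mu> prot tr = chain_from \<mu> prot [] 0 tr"

definition ledger_protocol :: "('p::finite \<Rightarrow> real) \<Rightarrow> ('p, 'd, 'c) protocol \<Rightarrow> bool" where
  "ledger_protocol \<mu> prot \<longleftrightarrow>
     (\<forall>e \<in> set_pmf (elections prot). length e = num_slots prot) \<and>
     (\<forall>C. quorum prot C \<ge> 0) \<and>
     (\<forall>A. A \<noteq> {} \<longrightarrow> select prot A \<in> A) \<and>
     (\<forall>P c h l C. length h < num_slots prot \<longrightarrow>
        (if P = l
         then \<exists>b. propose (honest prot) P c h l C = {b} \<and>
                  b \<in> eligible prot (chain \<mu> prot h) (length h) l {b}
         else propose (honest prot) P c h l C = {})) \<and>
     (\<forall>P c h l C props. length h < num_slots prot \<longrightarrow>
        sign (honest prot) P c h l C props =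
          (let E = eligible prot (chain \<mu> prot h) (length h) l (props l)
           in if P \<in> C \<and> E \<noteq> {} then {select prot E} else {}))"

definition play_slot ::
  "('p \<Rightarrow> 'c) \<Rightarrow> ('p, 'd, 'c) profile \<Rightarrow> ('p, 'd) trace \<Rightarrow> 'p \<Rightarrow> 'p set \<Rightarrow> ('p, 'd) slot_log" where
  "play_slot \<rho> \<sigma> h l C =
     (let props = (\<lambda>P. propose (\<sigma> P) P (\<rho> P) h l C)
      in \<lparr>leader = l, committee = C, proposals = props,
          signatures = (\<lambda>P. sign (\<sigma> P) P (\<rho> P) h l C props)\<rparr>)"

primrec run ::
  "('p \<Rightarrow> 'c) \<Rightarrow> ('p, 'd, 'c) profile \<Rightarrow> ('p, 'd) trace \<Rightarrow> ('p \<times> 'p set) list \<Rightarrow> ('p, 'd) trace" where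
  "run \<rho> \<sigma> h [] = h"
| "run \<rho> \<sigma> h (lC # e) = run \<rho> \<sigma> (h @ [play_slot \<rho> \<sigma> h (fst lC) (snd lC)]) e"

definition execution ::
  "('p, 'd, 'c) protocol \<Rightarrow> ('p, 'd, 'c) profile \<Rightarrow> ('p, 'd) trace pmf" where
  "execution prot \<sigma> =
     map_pmf (\<lambda>(e, \<rho>). run \<rho> \<sigma> [] e) (pair_pmf (elections prot) (coins prot))"

section \<open>Games\<close>

definition profiles :: "'s set \<Rightarrow> ('p \<Rightarrow> 's) set" where
  "profiles S = {\<sigma>. \<forall>P. \<sigma> P \<in> S}"

definition nash_equilibrium ::
  "'s set \<Rightarrow> ('p \<Rightarrow> ('p \<Rightarrow> 's) \<Rightarrow> real) \<Rightarrow> real \<Rightarrow> ('p \<Rightarrow> 's) \<Rightarrow> bool" where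
  "nash_equilibrium S U \<epsilon> \<sigma> \<longleftrightarrow>
     \<sigma> \<in> profiles S \<and> (\<forall>P. \<forall>s \<in> S - {\<sigma> P}. U P \<sigma> \<ge> U P (\<sigma>(P := s)) - \<epsilon>)"

definition welfare :: "('p::finite \<Rightarrow> ('p \<Rightarrow> 's) \<Rightarrow> real) \<Rightarrow> ('p \<Rightarrow> 's) \<Rightarrow> real" where
  "welfare U \<sigma> = (\<Sum>P\<in>UNIV. U P \<sigma>)"

text \<open>Supremum and infimum replace maximum and minimum, which need not be attained. A quotient of a
  positive number by \<open>0\<close> is \<open>\<infinity>\<close>. The price is taken at one security parameter and for a tolerance \<open>\<epsilon>\<close>:
  a minimum at fixed \<open>\<kappa>\<close> over all families of profiles that are equilibria up to some negligible
  function would range over all profiles, since a negligible function may have any value at \<open>\<kappa>\<close>.\<close>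

definition price_of_anarchy ::
  "'s set \<Rightarrow> ('p::finite \<Rightarrow> ('p \<Rightarrow> 's) \<Rightarrow> real) \<Rightarrow> real \<Rightarrow> ereal" where
  "price_of_anarchy S U \<epsilon> =
     (SUP \<sigma> \<in> profiles S. ereal (welfare U \<sigma>)) /
     (INF \<sigma> \<in> {\<sigma>. nash_equilibrium S U \<epsilon> \<sigma>}. ereal (welfare U \<sigma>))"

section \<open>Rewards and utility\<close>

definition blocks_created ::
  "('p::finite \<Rightarrow> real) \<Rightarrow> ('p, 'd, 'c) protocol \<Rightarrow> 'p \<Rightarrow> ('p, 'd) trace \<Rightarrow> nat" where
  "blocks_created \<mu> prot P tr = length (filter (\<lambda>b. creator b = P) (chain \<mu> prot tr))"

definition ledger_reward ::
  "('p::finite \<Rightarrow> real) \<Rightarrow> ('p, 'd, 'c) protocol \<Rightarrow> real \<Rightarrow> 'p \<Rightarrow> ('p, 'd) trace \<Rightarrow> real" where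
  "ledger_reward \<mu> prot R P tr = real (blocks_created \<mu> prot P tr) * R"

text \<open>The utility Reward, for a distribution of traces, the stake of a party, its ledger rewards, the
  exchange rate and its external rewards.\<close>

definition reward_utility ::
  "'t pmf \<Rightarrow> real \<Rightarrow> ('t \<Rightarrow> real) \<Rightarrow> ('t \<Rightarrow> real) \<Rightarrow> ('t \<Rightarrow> real) \<Rightarrow> real" where
  "reward_utility D stk Rew X B =
     measure_pmf.expectation D (\<lambda>tr. stk * X tr) +
     measure_pmf.expectation D (\<lambda>tr. Rew tr * X tr) +
     measure_pmf.expectation D B"

definition honest_profile :: "('p, 'd, 'c) protocol \<Rightarrow> ('p, 'd, 'c) profile" where
  "honest_profile prot = (\<lambda>P. honest prot)"

definition standing_assumptions ::
  "('p::finite \<Rightarrow> real) \<Rightarrow> ('p, 'd, 'c) protocol \<Rightarrow> ('p, 'd, 'c) strategy set \<Rightarrow> real \<Rightarrow> bool" where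
  "standing_assumptions \<mu> prot S R \<longleftrightarrow>
     (\<forall>\<sigma> \<in> profiles S.
        measure_pmf.expectation (execution prot \<sigma>) (\<lambda>tr. \<Sum>P\<in>UNIV. ledger_reward \<mu> prot R P tr)
        \<le> measure_pmf.expectation (execution prot (honest_profile prot))
             (\<lambda>tr. \<Sum>P\<in>UNIV. ledger_reward \<mu> prot R P tr)) \<and>
     (\<forall>tr \<in> set_pmf (execution prot (honest_profile prot)).
        map bslot (chain \<mu> prot tr) = [0..<num_slots prot]) \<and>
     (\<forall>P. \<forall>\<theta>\<in>{0<..<1}.
        let D = execution prot (honest_profile prot);
            M = (\<lambda>tr. real (blocks_created \<mu> prot P tr));
            m = measure_pmf.expectation D M
        in measure_pmf.prob D {tr. M tr \<ge> (1 + \<theta>) * m} \<le> exp (- (\<theta>\<^sup>2 / 3 * m)) \<and>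
           measure_pmf.prob D {tr. M tr \<le> (1 - \<theta>) * m} \<le> exp (- (\<theta>\<^sup>2 / 2 * m)))"

section \<open>Infractions\<close>

definition valid_chain :: "('p, 'd, 'c) protocol \<Rightarrow> ('p, 'd) block list \<Rightarrow> bool" where
  "valid_chain prot C \<longleftrightarrow>
     sorted_wrt (<) (map bslot C) \<and> (\<forall>i < length C. valid_ext prot (take i C) (C ! i))"

definition conflicting :: "('p, 'd, 'c) protocol \<Rightarrow> ('p, 'd) block \<Rightarrow> ('p, 'd) block \<Rightarrow> bool" where
  "conflicting prot b b' \<longleftrightarrow> b \<noteq> b' \<and> (\<forall>C. {b, b'} \<subseteq> set C \<longrightarrow> \<not> valid_chain prot C)"

text \<open>Only a leader can propose, and only a member of the committee can sign; what other parties send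
  is void. Conflicting blocks are required to be issued in one slot: if validity depends on
  predecessors, an honest party may have to sign conflicting blocks in different slots.
  The infraction predicate below may punish more than this.\<close>

definition issued :: "('p, 'd) slot_log \<Rightarrow> 'p \<Rightarrow> ('p, 'd) block set" where
  "issued s P = (if P = leader s then proposals s P else {}) \<union>
                (if P \<in> committee s then signatures s P else {})"

definition double_signs ::
  "('p, 'd, 'c) protocol \<Rightarrow> nat set \<Rightarrow> ('p, 'd) trace \<Rightarrow> 'p \<Rightarrow> bool" where
  "double_signs prot \<Delta> tr P \<longleftrightarrow>
     (\<exists>t \<in> \<Delta>. t < length tr \<and> (\<exists>b \<in> issued (tr ! t) P. \<exists>b' \<in> issued (tr ! t) P. conflicting prot b b'))"

text \<open>A safety infraction predicate for the time frame \<open>\<Delta>\<close>, a set of slots: double signing is an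
  infraction, and following the protocol is not.\<close>

definition infraction_predicate ::
  "('p, 'd, 'c) protocol \<Rightarrow> ('p, 'd, 'c) strategy set \<Rightarrow> nat set \<Rightarrow> (('p, 'd) trace \<Rightarrow> 'p \<Rightarrow> bool)
     \<Rightarrow> bool" where
  "infraction_predicate prot S \<Delta> IP \<longleftrightarrow>
     (\<forall>\<sigma> \<in> profiles S. \<forall>tr \<in> set_pmf (execution prot \<sigma>). \<forall>P.
        (double_signs prot \<Delta> tr P \<longrightarrow> IP tr P) \<and> (\<sigma> P = honest prot \<longrightarrow> \<not> IP tr P))"

text \<open>Double signing whenever elected, and honest behaviour otherwise: all messages of the honest
  strategy are sent as well.\<close>

definition infraction_strategy ::
  "('p, 'd, 'c) protocol \<Rightarrow> ('p, 'd, 'c) strategy \<Rightarrow> bool" where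
  "infraction_strategy prot S_IP \<longleftrightarrow>
     (\<forall>P c h l C.
        let p = propose S_IP P c h l C; p' = propose (honest prot) P c h l C
        in p' \<subseteq> p \<and> (if P = l then \<exists>b\<in>p. \<exists>b'\<in>p. conflicting prot b b' else p = p')) \<and>
     (\<forall>P c h l C props.
        let s = sign S_IP P c h l C props; s' = sign (honest prot) P c h l C props
        in s' \<subseteq> s \<and> (if P \<in> C then \<exists>b\<in>s. \<exists>b'\<in>s. conflicting prot b b' else s = s'))"

definition infraction_succeeds ::
  "(nat \<Rightarrow> ('p, 'd, 'c) protocol) \<Rightarrow> (nat \<Rightarrow> ('p, 'd, 'c) strategy set) \<Rightarrow> (nat \<Rightarrow> nat set)
     \<Rightarrow> (nat \<Rightarrow> ('p, 'd, 'c) strategy) \<Rightarrow> bool" where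
  "infraction_succeeds prot S \<Delta> S_IP \<longleftrightarrow>
     (\<exists>\<delta>. negl \<delta> \<and>
        (\<forall>\<kappa>. \<forall>\<sigma> \<in> profiles (S \<kappa>). \<forall>P. \<sigma> P = S_IP \<kappa> \<longrightarrow>
           measure_pmf.prob (execution (prot \<kappa>) \<sigma>) {tr. \<not> double_signs (prot \<kappa>) (\<Delta> \<kappa>) tr P} \<le> \<delta> \<kappa>))"

text \<open>The attack succeeds if parties of aggregate power at least \<open>\<alpha>\<close> perform the infraction; this is
  the event that lowers the exchange rate.\<close>

definition security_threshold ::
  "('p::finite \<Rightarrow> real) \<Rightarrow> (nat \<Rightarrow> ('p, 'd, 'c) protocol) \<Rightarrow> (nat \<Rightarrow> ('p, 'd, 'c) strategy set)
     \<Rightarrow> (nat \<Rightarrow> ('p, 'd) trace \<Rightarrow> 'p \<Rightarrow> bool) \<Rightarrow> (nat \<Rightarrow> ('p, 'd, 'c) strategy) \<Rightarrow> real \<Rightarrow> bool" where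
  "security_threshold \<mu> prot S IP S_IP \<alpha> \<longleftrightarrow>
     0 < \<alpha> \<and> \<alpha> < 1 \<and>
     (\<exists>\<delta>. negl \<delta> \<and>
        (\<forall>\<kappa>. \<forall>\<sigma> \<in> profiles (S \<kappa>). \<forall>A. (\<Sum>P\<in>A. \<mu> P) \<ge> \<alpha> \<and> (\<forall>P\<in>A. \<sigma> P = S_IP \<kappa>) \<longrightarrow>
           measure_pmf.prob (execution (prot \<kappa>) \<sigma>) {tr. (\<Sum>P | IP \<kappa> tr P. \<mu> P) \<ge> \<alpha>} \<ge> 1 - \<delta> \<kappa>))"

text \<open>The probability that, in some slot, \<open>P\<close> alone has enough power to certify a block. A party that
  can do so obtains block rewards even if nobody else signs any block.\<close>

definition prob_sole_quorum ::
  "('p \<Rightarrow> real) \<Rightarrow> ('p, 'd, 'c) protocol \<Rightarrow> 'p \<Rightarrow> real" where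
  "prob_sole_quorum \<mu> prot P =
     measure_pmf.prob (elections prot) {e. \<exists>(l, C) \<in> set e. P \<in> C \<and> \<mu> P > quorum prot C}"

section \<open>Admissible strategies\<close>

text \<open>A hard-wired strategy proposes and signs, in every slot \<open>t\<close>, the blocks
  \<open>Block (t + k) q d\<close> for the entries \<open>(k, q, d)\<close> of a fixed table.\<close>

definition table_strategy :: "(nat \<times> 'p \<times> 'd) set \<Rightarrow> ('p, 'd, 'c) strategy" where
  "table_strategy T =
     \<lparr>propose = (\<lambda>P c h l C. {Block (length h + k) q d | k q d. (k, q, d) \<in> T}),
      sign = (\<lambda>P c h l C props. {Block (length h + k) q d | k q d. (k, q, d) \<in> T})\<rparr>"

text \<open>\<open>S \<kappa>\<close> stands for the strategies which are efficient at security parameter \<open>\<kappa>\<close>. No machine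
  model is fixed: any class will do that contains the two strategies in question and, for
  sufficiently large \<open>\<kappa>\<close>, each fixed finite table.\<close>

definition strategy_space ::
  "(nat \<Rightarrow> ('p, 'd, 'c) protocol) \<Rightarrow> (nat \<Rightarrow> ('p, 'd, 'c) strategy)
     \<Rightarrow> (nat \<Rightarrow> ('p, 'd, 'c) strategy set) \<Rightarrow> bool" where
  "strategy_space prot S_IP S \<longleftrightarrow>
     (\<forall>\<kappa>. honest (prot \<kappa>) \<in> S \<kappa> \<and> S_IP \<kappa> \<in> S \<kappa>) \<and>
     (\<forall>T. finite T \<longrightarrow> (\<forall>\<^sub>F \<kappa> in sequentially. table_strategy T \<in> S \<kappa>))"

end

theory Submission
  imports Defs
begin

text \<open>The honest profile has welfare \<open>(stake + N R) x_max\<close>, so it suffices to exhibit equilibria of small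
  welfare. A profile in which every party double signs is one: since \<open>\<mu>\<^sub>P \<le> 1 - \<alpha>\<close>, the others alone bring the
  exchange rate down to \<open>x_min\<close> up to negligible probability, and a deviating party can only gain ledger
  rewards or lose its bribe.

  For the first lower bound everybody plays the infraction strategy. Each slot still adds a block of its
  leader, which already gives each party the largest number of blocks that it can have in any execution.

  For the second bound everybody signs conflicting blocks with a wrong slot number, so that the chain stays
  empty; a deviating party earns ledger rewards only if its own power is a quorum.

  Finiteness: in any equilibrium each party has almost its bribe as utility, because it could switch to the
  infraction strategy. So the welfare of an equilibrium is at least about the sum of the bribes.\<close>

section \<open>Negligible functions\<close>

lemma negl_mono:
  assumes "negl g" "\<forall>\<^sub>F \<kappa> in sequentially. \<bar>f \<kappa>\<bar> \<le> \<bar>g \<kappa>\<bar>"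
  shows "negl f"
  unfolding negl_def
proof
  fix c :: nat
  have "\<forall>\<^sub>F \<kappa> in sequentially. \<bar>g \<kappa>\<bar> < 1 / real \<kappa> ^ c" using assms(1) by (simp add: negl_def)
  then show "\<forall>\<^sub>F \<kappa> in sequentially. \<bar>f \<kappa>\<bar> < 1 / real \<kappa> ^ c"
    using assms(2) by eventually_elim simp
qed

lemma negl_add:
  assumes "negl f" "negl g"
  shows "negl (\<lambda>\<kappa>. f \<kappa> + g \<kappa>)"
  unfolding negl_def
proof
  fix c :: nat
  \<comment> \<open>The spare power of \<kappa> absorbs the factor 2 as soon as \<kappa> \<ge>
    2.\<close>
  have "\<forall>\<^sub>F \<kappa> in sequentially. \<bar>f \<kappa>\<bar> < 1 / real \<kappa> ^ Suc c" "\<forall>\<^sub>F \<kappa> in sequentially. \<bar>g \<kappa>\<bar> < 1 / real \<kappa> ^ Suc c"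
    using assms unfolding negl_def by blast+
  then show "\<forall>\<^sub>F \<kappa> in sequentially. \<bar>f \<kappa> + g \<kappa>\<bar> < 1 / real \<kappa> ^ c"
    using eventually_ge_at_top[of 2]
  proof eventually_elim
    case (elim \<kappa>)
    have "\<bar>f \<kappa> + g \<kappa>\<bar> < 2 / real \<kappa> ^ Suc c" using elim by linarith
    also have "\<dots> \<le> 1 / real \<kappa> ^ c" using elim(3) by (simp add: field_simps)
    finally show ?case .
  qed
qed

lemma negl_zero: "negl (\<lambda>\<kappa>. 0)"
  unfolding negl_def
proof
  fix c :: nat
  show "\<forall>\<^sub>F \<kappa> in sequentially. \<bar>0::real\<bar> < 1 / real \<kappa> ^ c"
    using eventually_gt_at_top[of 0] by eventually_elim simp
qed

lemma negl_sum:
  assumes "\<And>i. i \<in> I \<Longrightarrow> negl (f i)"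
  shows "negl (\<lambda>\<kappa>. \<Sum>i\<in>I. f i \<kappa>)"
  using assms
  by (induction I rule: infinite_finite_induct) (auto simp: negl_zero intro: negl_add)

lemma negl_mult_poly:
  assumes "negl f" "\<forall>\<^sub>F \<kappa> in sequentially. \<bar>g \<kappa>\<bar> \<le> real \<kappa> ^ d"
  shows "negl (\<lambda>\<kappa>. g \<kappa> * f \<kappa>)"
  unfolding negl_def
proof
  fix c :: nat
  have "\<forall>\<^sub>F \<kappa> in sequentially. \<bar>f \<kappa>\<bar> < 1 / real \<kappa> ^ (d + c)"
    using assms(1) unfolding negl_def by blast
  then show "\<forall>\<^sub>F \<kappa> in sequentially. \<bar>g \<kappa> * f \<kappa>\<bar> < 1 / real \<kappa> ^ c"
    using assms(2) eventually_gt_at_top[of 0]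
  proof eventually_elim
    case (elim \<kappa>)
    have "\<bar>g \<kappa> * f \<kappa>\<bar> \<le> real \<kappa> ^ d * \<bar>f \<kappa>\<bar>"
      using elim(2) by (simp add: abs_mult mult_right_mono)
    also have "\<dots> < real \<kappa> ^ d * (1 / real \<kappa> ^ (d + c))"
      using elim by (intro mult_strict_left_mono) auto
    also have "\<dots> = 1 / real \<kappa> ^ c" using elim(3) by (simp add: power_add)
    finally show ?case .
  qed
qed

lemma negl_cmult:
  assumes "negl f"
  shows "negl (\<lambda>\<kappa>. a * f \<kappa>)"
proof (rule negl_mult_poly[OF assms, where d = 1])
  \<comment> \<open>A constant is eventually below \<kappa> itself, so it counts as a polynomial
    factor of degree 1.\<close>
  show "\<forall>\<^sub>F \<kappa> in sequentially. \<bar>a\<bar> \<le> real \<kappa> ^ 1"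
    using eventually_ge_at_top[of "nat \<lceil>\<bar>a\<bar>\<rceil>"] by eventually_elim simp
qed

lemma negl_mult_poly_bounded:
  assumes "negl f" "poly_bounded N"
  shows "negl (\<lambda>\<kappa>. real (N \<kappa>) * f \<kappa>)"
proof -
  obtain d where "\<forall>\<^sub>F \<kappa> in sequentially. N \<kappa> \<le> \<kappa> ^ d"
    using assms(2) unfolding poly_bounded_def by blast
  then have "\<forall>\<^sub>F \<kappa> in sequentially. \<bar>real (N \<kappa>)\<bar> \<le> real \<kappa> ^ d"
    by eventually_elim (simp flip: of_nat_power)
  then show ?thesis by (rule negl_mult_poly[OF assms(1)])
qed

section \<open>Executions and chains\<close>

text \<open>The part of a trace that no strategy can influence. Different profiles are compared by
  projecting their executions to it.\<close>

definition elected :: "('p, 'd) trace \<Rightarrow> ('p \<times> 'p set) list" where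
  "elected tr = map (\<lambda>s. (leader s, committee s)) tr"

text \<open>Serves as the upper bound on the number of blocks of \<open>P\<close>, independent of
  all strategies.\<close>

definition lead_slots :: "'p \<Rightarrow> ('p \<times> 'p set) list \<Rightarrow> nat" where
  "lead_slots P e = length (filter (\<lambda>lC. fst lC = P) e)"

lemma run_snoc:
  "run \<rho> \<sigma> h (e @ [lC]) =
     run \<rho> \<sigma> h e @ [play_slot \<rho> \<sigma> (run \<rho> \<sigma> h e) (fst lC) (snd lC)]"
  by (induction e arbitrary: h) auto

lemma length_run [simp]: "length (run \<rho> \<sigma> h e) = length h + length e"
  by (induction e arbitrary: h) auto

lemma elected_run: "elected (run \<rho> \<sigma> [] e) = e"
  by (induction e rule: rev_induct) (auto simp: elected_def run_snoc play_slot_def Let_def)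

lemma run_nth:
  assumes "t < length e"
  shows "run \<rho> \<sigma> [] e ! t = play_slot \<rho> \<sigma> (run \<rho> \<sigma> [] (take t e)) (fst (e ! t)) (snd (e ! t))"
  using assms by (induction e rule: rev_induct) (auto simp: run_snoc nth_append less_Suc_eq)

lemma chain_from_snoc:
  "chain_from \<mu> prot C t (h @ [s]) = append_slot \<mu> prot (chain_from \<mu> prot C t h) (t + length h) s"
  by (induction h arbitrary: C t) auto

lemma chain_snoc: "chain \<mu> prot (h @ [s]) = append_slot \<mu> prot (chain \<mu> prot h) (length h) s"
  by (simp add: chain_def chain_from_snoc)

lemma chain_Nil [simp]: "chain \<mu> prot [] = []"
  by (simp add: chain_def)

lemma length_append_slot_le: "length (append_slot \<mu> prot C t s) \<le> Suc (length C)"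
  by (simp add: append_slot_def Let_def)

lemma length_chain_le: "length (chain \<mu> prot tr) \<le> length tr"
proof (induction tr rule: rev_induct)
  case (snoc s tr)
  then show ?case
    using length_append_slot_le[of \<mu> prot "chain \<mu> prot tr" "length tr" s] by (simp add: chain_snoc)
qed simp

lemma blocks_created_le: "blocks_created \<mu> prot P tr \<le> length tr"
  unfolding blocks_created_def
  using length_filter_le length_chain_le le_trans by metis

lemma sum_blocks_created:
  "(\<Sum>P\<in>UNIV. blocks_created \<mu> prot P tr) = length (chain \<mu> prot tr)"
proof -
  have "(\<Sum>P\<in>UNIV. length (filter (\<lambda>b. creator b = P) C)) = length C" for C :: "('a::finite, 'b) block list"
  proof (induction C)
    case (Cons c C)
    have "(\<Sum>P\<in>UNIV. length (filter (\<lambda>b. creator b = P) (c # C))) =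
          (\<Sum>P\<in>UNIV. (if P = creator c then 1 else 0) + length (filter (\<lambda>b. creator b = P) C))"
      by (intro sum.cong) auto
    then show ?case using Cons by (simp add: sum.distrib)
  qed simp
  then show ?thesis by (simp add: blocks_created_def)
qed

section \<open>What a single slot can add to the chain\<close>

lemma ledger_protocolD:
  assumes "ledger_protocol \<mu> prot"
  shows "e \<in> set_pmf (elections prot) \<Longrightarrow> length e = num_slots prot"
    and "0 \<le> quorum prot C"
    and "A \<noteq> {} \<Longrightarrow> select prot A \<in> A"
    and "length h < num_slots prot \<Longrightarrow>
      \<exists>b. propose (honest prot) l c h l C = {b} \<and> b \<in> eligible prot (chain \<mu> prot h) (length h) l {b}"
    and "length h < num_slots prot \<Longrightarrow> P \<in> C \<Longrightarrow>
      eligible prot (chain \<mu> prot h) (length h) l (props l) \<noteq> {} \<Longrightarrow>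
      sign (honest prot) P c h l C props =
        {select prot (eligible prot (chain \<mu> prot h) (length h) l (props l))}"
proof -
  note * = assms[unfolded ledger_protocol_def]
  show "e \<in> set_pmf (elections prot) \<Longrightarrow> length e = num_slots prot" "0 \<le> quorum prot C"
    "A \<noteq> {} \<Longrightarrow> select prot A \<in> A"
    using * by blast+
  note ** = *[THEN conjunct2, THEN conjunct2, THEN conjunct2]
  show "\<exists>b. propose (honest prot) l c h l C = {b} \<and> b \<in> eligible prot (chain \<mu> prot h) (length h) l {b}"
    if "length h < num_slots prot"
    using **[THEN conjunct1, rule_format, OF that, where P = l and l = l and c = c and C = C]
    by (simp only: if_True refl)
  show "sign (honest prot) P c h l C props =
      {select prot (eligible prot (chain \<mu> prot h) (length h) l (props l))}"
    if "length h < num_slots prot" "P \<in> C"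
      "eligible prot (chain \<mu> prot h) (length h) l (props l) \<noteq> {}"
    using **[THEN conjunct2, rule_format, OF that(1), where P = P and l = l and c = c and C = C and props = props]
      that(2,3) by (simp only: Let_def if_True simp_thms)
qed

lemma append_slot_cases:
  assumes "ledger_protocol \<mu> prot"
  shows "append_slot \<mu> prot C t s = C \<or> (\<exists>b. append_slot \<mu> prot C t s = C @ [b] \<and> creator b = leader s)"
proof -
  define Q where "Q = eligible prot C t (leader s) (proposals s (leader s)) \<inter> certified \<mu> prot s"
  show ?thesis
  proof (cases "Q = {}")
    case True
    then show ?thesis by (simp add: append_slot_def Let_def Q_def)
  next
    case False
    then have "select prot Q \<in> Q" by (rule ledger_protocolD(3)[OF assms])
    then have "creator (select prot Q) = leader s" by (simp add: Q_def eligible_def)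
    moreover have "append_slot \<mu> prot C t s = C @ [select prot Q]"
      using False by (simp add: append_slot_def Let_def Q_def)
    ultimately show ?thesis by blast
  qed
qed

text \<open>A slot adds at most one block and its creator is the elected leader, however the parties
  behave.\<close>

lemma blocks_created_le_lead_slots:
  assumes "ledger_protocol \<mu> prot"
  shows "blocks_created \<mu> prot P tr \<le> lead_slots P (elected tr)"
proof (induction tr rule: rev_induct)
  case (snoc s tr)
  consider "chain \<mu> prot (tr @ [s]) = chain \<mu> prot tr"
    | b where "chain \<mu> prot (tr @ [s]) = chain \<mu> prot tr @ [b]" "creator b = leader s"
    using append_slot_cases[OF assms, of "chain \<mu> prot tr" "length tr" s]
    unfolding chain_snoc by blast
  then show ?case
  proof cases
    case 1
    then show ?thesis using snoc by (simp add: blocks_created_def lead_slots_def elected_def)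
  next
    case 2
    then show ?thesis using snoc by (simp add: blocks_created_def lead_slots_def elected_def)
  qed
qed (simp add: blocks_created_def)

text \<open>A full chain received a certified block in every slot, and the signers of a certified
  block lie in the committee. The protocol conditions alone do not say that a committee can reach
  its quorum; this is read off from executions with a full chain.\<close>

lemma quorum_if_full_chain:
  fixes \<mu> :: "'p::finite \<Rightarrow> real"
  assumes "\<And>P. 0 \<le> \<mu> P" "length (chain \<mu> prot tr) = length tr" "(l, C) \<in> set (elected tr)"
  shows "quorum prot C < sum \<mu> C"
  using assms(2,3)
proof (induction tr rule: rev_induct)
  case (snoc s tr)
  let ?Q = "eligible prot (chain \<mu> prot tr) (length tr) (leader s) (proposals s (leader s)) \<inter> certified \<mu> prot s"
  have le: "length (chain \<mu> prot tr) \<le> length tr" by (rule length_chain_le)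
  \<comment> \<open>Before the last slot the chain has at most \<open>length tr\<close> blocks, so
    full length afterwards forces this slot to contribute one.\<close>
  have "?Q \<noteq> {}"
    using snoc.prems(1) le by (auto simp: chain_snoc append_slot_def Let_def split: if_splits)
  then obtain b where "b \<in> certified \<mu> prot s" by blast
  moreover have "(\<Sum>P | P \<in> committee s \<and> b \<in> signatures s P. \<mu> P) \<le> sum \<mu> (committee s)" for b
    by (intro sum_mono2) (auto simp: assms(1))
  ultimately have "quorum prot (committee s) < sum \<mu> (committee s)"
    unfolding certified_def by (auto intro: less_le_trans)
  moreover have "length (chain \<mu> prot tr) = length tr"
    using snoc.prems(1) le length_append_slot_le[of \<mu> prot "chain \<mu> prot tr" "length tr" s]
    by (simp add: chain_snoc)
  moreover have "(l, C) = (leader s, committee s) \<or> (l, C) \<in> set (elected tr)"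
    using snoc.prems(2) by (simp add: elected_def)
  ultimately show ?case using snoc.IH by blast
qed (simp add: elected_def)

text \<open>All members of the committee also send their honest signatures, and these are for one and the same
  block, so double signing by everybody does not keep the chain from growing in every slot.\<close>

lemma append_slot_infraction:
  fixes \<mu> :: "'p::finite \<Rightarrow> real"
  assumes prot: "ledger_protocol \<mu> prot" and S_IP: "infraction_strategy prot S_IP"
    and quorum: "quorum prot C < sum \<mu> C" and h: "length h < num_slots prot"
  shows "\<exists>b. append_slot \<mu> prot (chain \<mu> prot h) (length h) (play_slot \<rho> (\<lambda>P. S_IP) h l C)
    = chain \<mu> prot h @ [b] \<and> creator b = l"
proof -
  define s where "s = play_slot \<rho> (\<lambda>P. S_IP) h l C"
  have s: "leader s = l" "committee s = C" "proposals s = (\<lambda>P. propose S_IP P (\<rho> P) h l C)"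
    "signatures s = (\<lambda>P. sign S_IP P (\<rho> P) h l C (proposals s))"
    by (simp_all add: s_def play_slot_def Let_def)
  define E where "E = eligible prot (chain \<mu> prot h) (length h) l (proposals s l)"
  obtain b where b: "propose (honest prot) l (\<rho> l) h l C = {b}"
      "b \<in> eligible prot (chain \<mu> prot h) (length h) l {b}"
    using ledger_protocolD(4)[OF prot h] by blast
  have "propose (honest prot) l (\<rho> l) h l C \<subseteq> proposals s l"
    using S_IP unfolding infraction_strategy_def Let_def s by blast
  then have E: "E \<noteq> {}" using b by (auto simp: E_def eligible_def)
  then have select: "select prot E \<in> E" by (rule ledger_protocolD(3)[OF prot])
  \<comment> \<open>All members see the same proposals, the additional ones included, hence the same
    \<open>E\<close>; their honest signatures therefore agree.\<close>
  have "select prot E \<in> signatures s P" if "P \<in> C" for P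
  proof -
    have "sign (honest prot) P (\<rho> P) h l C (proposals s) = {select prot E}"
      using ledger_protocolD(5)[OF prot h that, of l "proposals s"] E by (simp add: E_def)
    moreover have "sign (honest prot) P (\<rho> P) h l C (proposals s) \<subseteq> signatures s P"
      using S_IP unfolding infraction_strategy_def Let_def s by blast
    ultimately show ?thesis by blast
  qed
  then have "{P. P \<in> committee s \<and> select prot E \<in> signatures s P} = C" by (auto simp: s)
  then have "select prot E \<in> certified \<mu> prot s" using quorum by (simp add: certified_def s(2))
  \<comment> \<open>Double signing may certify further blocks, so the appended block need not be
    \<open>select prot E\<close>. Every element of \<open>E\<close> was created by \<open>l\<close>,
    and that suffices.\<close>
  then have Q: "E \<inter> certified \<mu> prot s \<noteq> {}" using select by blast
  then have "select prot (E \<inter> certified \<mu> prot s) \<in> E \<inter> certified \<mu> prot s"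
    by (rule ledger_protocolD(3)[OF prot])
  then have "creator (select prot (E \<inter> certified \<mu> prot s)) = l" by (simp add: E_def eligible_def)
  moreover have "append_slot \<mu> prot (chain \<mu> prot h) (length h) s =
      chain \<mu> prot h @ [select prot (E \<inter> certified \<mu> prot s)]"
    using Q by (simp add: append_slot_def Let_def s(1) E_def)
  ultimately show ?thesis unfolding s_def by blast
qed

text \<open>Every slot adds a block of its leader, so the bound by \<open>lead_slots\<close> is
  attained. The length of \<open>e\<close> is limited because the honest strategy is prescribed only
  in the first \<open>num_slots prot\<close> slots.\<close>

lemma blocks_created_infraction:
  fixes \<mu> :: "'p::finite \<Rightarrow> real"
  assumes prot: "ledger_protocol \<mu> prot" and S_IP: "infraction_strategy prot S_IP"
    and quorum: "\<And>l C. (l, C) \<in> set e \<Longrightarrow> quorum prot C < sum \<mu> C" and e: "length e \<le> num_slots prot"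
  shows "blocks_created \<mu> prot P (run \<rho> (\<lambda>P. S_IP) [] e) = lead_slots P e"
  using quorum e
proof (induction e rule: rev_induct)
  case (snoc lC e)
  obtain l C where lC: "lC = (l, C)" by fastforce
  let ?h = "run \<rho> (\<lambda>P. S_IP) [] e"
  have "(l, C) \<in> set (e @ [lC])" by (simp add: lC)
  then have "quorum prot C < sum \<mu> C" by (rule snoc.prems(1))
  moreover have "length ?h < num_slots prot" using snoc.prems(2) by simp
  ultimately have "\<exists>b. append_slot \<mu> prot (chain \<mu> prot ?h) (length ?h) (play_slot \<rho> (\<lambda>P. S_IP) ?h l C)
      = chain \<mu> prot ?h @ [b] \<and> creator b = l"
    by (rule append_slot_infraction[OF prot S_IP])
  then obtain b where b: "chain \<mu> prot (run \<rho> (\<lambda>P. S_IP) [] (e @ [lC])) = chain \<mu> prot ?h @ [b]"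
      "creator b = l"
    unfolding run_snoc chain_snoc lC fst_conv snd_conv by blast
  have "blocks_created \<mu> prot P ?h = lead_slots P e"
  proof (rule snoc.IH)
    fix l C assume "(l, C) \<in> set e"
    then have "(l, C) \<in> set (e @ [lC])" by simp
    then show "quorum prot C < sum \<mu> C" by (rule snoc.prems(1))
  qed (use snoc.prems(2) in simp)
  then show ?case unfolding blocks_created_def b(1) by (simp add: lead_slots_def lC b(2))
qed (simp add: blocks_created_def lead_slots_def)

text \<open>In slot \<open>t\<close>, blocks for slot \<open>t + 1\<close> are issued, one for each party: no two of them fit in one valid
  chain, and none of them is eligible in slot \<open>t\<close>. So this strategy double signs in every slot in which the
  party is elected, but certifies nothing.\<close>

definition premature :: "'d \<Rightarrow> ('p, 'd, 'c) strategy" where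
  "premature d = table_strategy {(1, q, d) | q. True}"

lemma propose_premature: "propose (premature d) P c h l C = {Block (Suc (length h)) q d | q. True}"
  by (auto simp: premature_def table_strategy_def)

lemma sign_premature: "sign (premature d) P c h l C props = {Block (Suc (length h)) q d | q. True}"
  by (auto simp: premature_def table_strategy_def)

text \<open>\<open>P\<close> is a possible deviator. Everybody else signs only blocks of the
  following slot, so an eligible block of the current slot can be signed by \<open>P\<close> alone,
  whose power is no quorum.\<close>

lemma chain_premature:
  fixes \<mu> :: "'p::finite \<Rightarrow> real"
  assumes "ledger_protocol \<mu> prot" and prem: "\<And>Q. Q \<noteq> P \<Longrightarrow> \<sigma> Q = premature d"
    and sole: "\<And>l C. (l, C) \<in> set e \<Longrightarrow> P \<in> C \<Longrightarrow> \<mu> P \<le> quorum prot C"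
  shows "chain \<mu> prot (run \<rho> \<sigma> [] e) = []"
  using sole
proof (induction e rule: rev_induct)
  case (snoc lC e)
  let ?h = "run \<rho> \<sigma> [] e" and ?C = "snd lC"
  let ?s = "play_slot \<rho> \<sigma> ?h (fst lC) ?C"
  have "b \<notin> certified \<mu> prot ?s" if "bslot b = length e" for b
  proof -
    have "{Q. Q \<in> committee ?s \<and> b \<in> signatures ?s Q} \<subseteq> {P} \<inter> ?C"
    proof
      fix Q assume Q: "Q \<in> {Q. Q \<in> committee ?s \<and> b \<in> signatures ?s Q}"
      have "Q = P"
      proof (rule ccontr)
        assume "Q \<noteq> P"
        then have "b \<in> {Block (Suc (length e)) q d | q. True}"
          using Q prem by (simp add: play_slot_def Let_def sign_premature)
        then show False using that by auto
      qed
      then show "Q \<in> {P} \<inter> ?C" using Q by (simp add: play_slot_def Let_def)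
    qed
    then consider "{Q. Q \<in> committee ?s \<and> b \<in> signatures ?s Q} = {}"
      | "{Q. Q \<in> committee ?s \<and> b \<in> signatures ?s Q} = {P}" "P \<in> ?C" by blast
    \<comment> \<open>With no signer the sum is 0, which does not exceed the nonnegative
      quorum.\<close>
    then have "(\<Sum>Q | Q \<in> committee ?s \<and> b \<in> signatures ?s Q. \<mu> Q) \<le> quorum prot ?C"
    proof cases
      case 1
      then show ?thesis using ledger_protocolD(2)[OF assms(1)] by (simp only: sum.empty)
    next
      case 2
      then show ?thesis using snoc.prems[of "fst lC" ?C] by (simp only: sum.insert) simp
    qed
    then show ?thesis by (simp add: certified_def play_slot_def Let_def)
  qed
  then have "eligible prot [] (length e) (leader ?s) (proposals ?s (leader ?s)) \<inter> certified \<mu> prot ?s = {}"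
    unfolding eligible_def by blast
  moreover have "chain \<mu> prot ?h = []" by (rule snoc.IH) (use snoc.prems in auto)
  ultimately show ?case by (simp add: run_snoc chain_snoc append_slot_def Let_def)
qed simp

text \<open>Slot numbers increase strictly along a valid chain, which thus holds at most one block
  per slot.\<close>

lemma conflicting_same_slot:
  assumes "b \<noteq> b'" "bslot b = bslot b'"
  shows "conflicting prot b b'"
  unfolding conflicting_def valid_chain_def
proof (intro conjI allI impI notI)
  fix C assume C: "{b, b'} \<subseteq> set C"
    and "sorted_wrt (<) (map bslot C) \<and> (\<forall>i<length C. valid_ext prot (take i C) (C ! i))"
  then have "distinct (map bslot C)" using strict_sorted_iff by blast
  then have "inj_on bslot (set C)" by (simp add: distinct_map)
  then show False using C assms by (auto dest: inj_onD)
qed (use assms(1) in auto)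

text \<open>An event of the elections alone: necessary for double signing under any strategy, and
  sufficient under \<open>premature\<close>.\<close>

definition has_turn :: "nat set \<Rightarrow> 'p \<Rightarrow> ('p \<times> 'p set) list \<Rightarrow> bool" where
  "has_turn \<Delta> P e \<longleftrightarrow> (\<exists>t\<in>\<Delta>. t < length e \<and> (P = fst (e ! t) \<or> P \<in> snd (e ! t)))"

lemma has_turn_if_double_signs:
  assumes "double_signs prot \<Delta> tr P"
  shows "has_turn \<Delta> P (elected tr)"
proof -
  obtain t b where t: "t \<in> \<Delta>" "t < length tr" "b \<in> issued (tr ! t) P"
    using assms unfolding double_signs_def by blast
  then have "P = leader (tr ! t) \<or> P \<in> committee (tr ! t)"
    by (auto simp: issued_def split: if_splits)
  then show ?thesis using t unfolding has_turn_def by (intro bexI[of _ t]) (auto simp: elected_def)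
qed

lemma double_signs_premature:
  fixes \<sigma> :: "('p, 'd, 'c) profile" and q q' :: 'p
  assumes "has_turn \<Delta> P e" "\<sigma> P = premature d" "q \<noteq> q'"
  shows "double_signs prot \<Delta> (run \<rho> \<sigma> [] e) P"
proof -
  obtain t where t: "t \<in> \<Delta>" "t < length e" "P = fst (e ! t) \<or> P \<in> snd (e ! t)"
    using assms(1) unfolding has_turn_def by blast
  have "issued (run \<rho> \<sigma> [] e ! t) P = {Block (Suc t) q d | q. True}"
    using t assms(2)
    by (auto simp: run_nth issued_def play_slot_def Let_def propose_premature sign_premature)
  \<comment> \<open>Two distinct parties named as creators make two distinct blocks of the same
    slot.\<close>
  moreover have "conflicting prot (Block (Suc t) q d) (Block (Suc t) q' d)"
    using assms(3) by (intro conflicting_same_slot) auto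
  ultimately have "\<exists>b\<in>issued (run \<rho> \<sigma> [] e ! t) P. \<exists>b'\<in>issued (run \<rho> \<sigma> [] e ! t) P. conflicting prot b b'"
    by blast
  then show ?thesis using t unfolding double_signs_def by auto
qed

text \<open>The logs reproduce the list of elections, and this list is drawn independently of the
  profile. So events and expectations that depend on elections only have the same value under all
  profiles.\<close>

lemma map_elected_execution: "map_pmf elected (execution prot \<sigma>) = elections prot"
proof -
  have "map_pmf elected (execution prot \<sigma>) = map_pmf fst (pair_pmf (elections prot) (coins prot))"
    unfolding execution_def pmf.map_comp by (intro map_pmf_cong) (auto simp: elected_run)
  then show ?thesis by (simp add: map_fst_pair_pmf)
qed

lemma prob_execution_elected:
  "measure_pmf.prob (execution prot \<sigma>) {tr. A (elected tr)} = measure_pmf.prob (elections prot) {e. A e}"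
  by (simp flip: map_elected_execution[of prot \<sigma>] add: vimage_def)

lemma expectation_execution_elected:
  fixes f :: "_ \<Rightarrow> real"
  shows "measure_pmf.expectation (execution prot \<sigma>) (\<lambda>tr. f (elected tr)) =
         measure_pmf.expectation (elections prot) f"
  by (simp flip: map_elected_execution[of prot \<sigma>])

lemma set_pmf_execution:
  "set_pmf (execution prot \<sigma>) = {run \<rho> \<sigma> [] e | \<rho> e. e \<in> set_pmf (elections prot) \<and> \<rho> \<in> set_pmf (coins prot)}"
  by (auto simp: execution_def)

section \<open>The game at one security parameter\<close>

text \<open>\<open>\<sigma>\<^sub>0\<close> bounds the supremum from below and
  \<open>\<sigma>\<^sub>1\<close> the infimum from above. Nonnegative welfare keeps the infimum
  where inversion is antitone; \<open>w = 0\<close> is covered because the inverse of 0 is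
  \<infinity>.\<close>

lemma price_of_anarchy_ge:
  assumes "\<sigma>\<^sub>0 \<in> profiles S" "0 \<le> a" "a \<le> welfare U \<sigma>\<^sub>0"
    and "nash_equilibrium S U \<epsilon> \<sigma>\<^sub>1" "welfare U \<sigma>\<^sub>1 \<le> w" "\<And>\<sigma>. 0 \<le> welfare U \<sigma>"
  shows "ereal a / ereal w \<le> price_of_anarchy S U \<epsilon>"
proof -
  let ?I = "INF \<sigma> \<in> {\<sigma>. nash_equilibrium S U \<epsilon> \<sigma>}. ereal (welfare U \<sigma>)"
  have I: "0 \<le> ?I" "?I \<le> ereal w"
    using assms(4-6) by (auto intro!: INF_greatest INF_lower2[of \<sigma>\<^sub>1])
  have "ereal a \<le> (SUP \<sigma> \<in> profiles S. ereal (welfare U \<sigma>))"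
    using assms(1,3) by (auto intro: SUP_upper2)
  moreover have "inverse (ereal w) \<le> inverse ?I" using I by (rule ereal_inverse_antimono)
  moreover have "0 \<le> inverse (ereal w)" using I by (metis order_trans ereal_inverse_nonneg_iff)
  moreover have "0 \<le> ereal a" using assms(2) by simp
  ultimately show ?thesis
    unfolding price_of_anarchy_def divide_ereal_def
    by (intro ereal_mult_mono) (rule order_trans)
qed

lemma price_of_anarchy_finite:
  assumes "\<And>\<sigma>. \<sigma> \<in> profiles S \<Longrightarrow> welfare U \<sigma> \<le> K" "0 \<le> K"
    and "0 < m" "\<And>\<sigma>. nash_equilibrium S U \<epsilon> \<sigma> \<Longrightarrow> m \<le> welfare U \<sigma>"
  shows "price_of_anarchy S U \<epsilon> < \<infinity>"
proof -
  define I where "I = (INF \<sigma> \<in> {\<sigma>. nash_equilibrium S U \<epsilon> \<sigma>}. ereal (welfare U \<sigma>))"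
  have I: "ereal m \<le> I"
    unfolding I_def using assms(4) by (auto intro!: INF_greatest)
  have "(SUP \<sigma> \<in> profiles S. ereal (welfare U \<sigma>)) \<le> ereal K"
    using assms(1) by (auto intro!: SUP_least)
  moreover have "0 < I" using I assms(3) less_le_trans[of 0 "ereal m" I] by simp
  ultimately have "price_of_anarchy S U \<epsilon> \<le> ereal K / I"
    unfolding price_of_anarchy_def I_def by (intro ereal_divide_right_mono)
  \<comment> \<open>If there is no equilibrium, then \<open>I\<close> is \<infinity> and the
    quotient is 0.\<close>
  also have "\<dots> < \<infinity>"
    using I assms(2,3) by (cases I) auto
  finally show ?thesis .
qed

section \<open>Expectations of bounded functions\<close>

lemma integrable_pmf_bounded:
  fixes f :: "'a \<Rightarrow> real"
  assumes "\<And>x. x \<in> set_pmf D \<Longrightarrow> \<bar>f x\<bar> \<le> K"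
  shows "integrable (measure_pmf D) f"
  by (rule measure_pmf.integrable_const_bound[where B = K]) (auto simp: AE_measure_pmf_iff assms)

lemma expectation_pmf_mono:
  fixes f g :: "'a \<Rightarrow> real"
  assumes "integrable (measure_pmf D) f" "integrable (measure_pmf D) g"
    and "\<And>x. x \<in> set_pmf D \<Longrightarrow> f x \<le> g x"
  shows "measure_pmf.expectation D f \<le> measure_pmf.expectation D g"
  by (rule integral_mono_AE) (auto simp: AE_measure_pmf_iff assms)

text \<open>The asymptotic hypotheses enter only through the number \<delta>, the failure
  probability of the infraction at this parameter. All estimates below are explicit in
  \<delta>.\<close>

locale bribed_ledger =
  fixes \<mu> :: "'p::finite \<Rightarrow> real"
    and prot :: "('p, 'd, 'c) protocol"
    and S :: "('p, 'd, 'c) strategy set"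
    and S_IP :: "('p, 'd, 'c) strategy"
    and \<Delta> :: "nat set"
    and IP :: "('p, 'd) trace \<Rightarrow> 'p \<Rightarrow> bool"
    and \<beta> :: "'p \<Rightarrow> real"
    and util :: "'p \<Rightarrow> ('p, 'd, 'c) profile \<Rightarrow> real"
    and \<alpha> R stake x_max x_min \<delta> :: real
  assumes power: "\<And>P. 0 \<le> \<mu> P" "(\<Sum>P\<in>UNIV. \<mu> P) = 1"
    and protocol: "ledger_protocol \<mu> prot"
    and strategies: "honest prot \<in> S" "S_IP \<in> S"
    and standing: "standing_assumptions \<mu> prot S R"
    and infraction: "infraction_predicate prot S \<Delta> IP"
    and strategy_IP: "infraction_strategy prot S_IP"
    and frame: "\<And>\<sigma> P. \<sigma> \<in> profiles S \<Longrightarrow> \<sigma> P = S_IP \<Longrightarrow>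
      measure_pmf.prob (execution prot \<sigma>) {tr. \<not> double_signs prot \<Delta> tr P} \<le> \<delta>"
    and threshold: "0 < \<alpha>"
    and constants: "0 < stake" "0 \<le> R" "0 \<le> x_min" "x_min < x_max"
    and bribes: "\<And>P. 0 \<le> \<beta> P"
    and utility: "\<And>P \<sigma>. util P \<sigma> =
      reward_utility (execution prot \<sigma>) (\<mu> P * stake) (ledger_reward \<mu> prot R P)
        (\<lambda>tr. if (\<Sum>P | IP tr P. \<mu> P) < \<alpha> then x_max else x_min) (\<lambda>tr. if IP tr P then \<beta> P else 0)"
begin

abbreviation expect :: "('p, 'd, 'c) profile \<Rightarrow> (('p, 'd) trace \<Rightarrow> real) \<Rightarrow> real" where
  "expect \<sigma> \<equiv> measure_pmf.expectation (execution prot \<sigma>)"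

abbreviation prob :: "('p, 'd, 'c) profile \<Rightarrow> (('p, 'd) trace \<Rightarrow> bool) \<Rightarrow> real" where
  "prob \<sigma> A \<equiv> measure_pmf.prob (execution prot \<sigma>) {tr. A tr}"

abbreviation slots :: real where
  "slots \<equiv> real (num_slots prot)"

definition rate :: "('p, 'd) trace \<Rightarrow> real" where
  "rate tr = (if (\<Sum>P | IP tr P. \<mu> P) < \<alpha> then x_max else x_min)"

definition blocks :: "'p \<Rightarrow> ('p, 'd, 'c) profile \<Rightarrow> real" where
  "blocks P \<sigma> = expect \<sigma> (\<lambda>tr. real (blocks_created \<mu> prot P tr))"

lemma length_trace:
  assumes "tr \<in> set_pmf (execution prot \<sigma>)"
  shows "length tr = num_slots prot"
  using assms ledger_protocolD(1)[OF protocol] by (auto simp: set_pmf_execution)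

section \<open>Numbers of blocks and their expectations\<close>

lemma blocks_created_le_slots:
  assumes "tr \<in> set_pmf (execution prot \<sigma>)"
  shows "real (blocks_created \<mu> prot P tr) \<le> slots"
  using blocks_created_le[of \<mu> prot P tr] length_trace[OF assms] by simp

lemma integrable_blocks: "integrable (execution prot \<sigma>) (\<lambda>tr. real (blocks_created \<mu> prot P tr))"
  using blocks_created_le_slots by (intro integrable_pmf_bounded[where K = slots]) auto

lemma blocks_nonneg: "0 \<le> blocks P \<sigma>"
  by (simp add: blocks_def)

lemma sum_blocks: "(\<Sum>P\<in>UNIV. blocks P \<sigma>) = expect \<sigma> (\<lambda>tr. real (length (chain \<mu> prot tr)))"
  unfolding blocks_def
  by (subst Bochner_Integration.integral_sum[symmetric])
     (auto simp: integrable_blocks simp flip: of_nat_sum sum_blocks_created)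

lemma sum_blocks_le: "(\<Sum>P\<in>UNIV. blocks P \<sigma>) \<le> slots"
proof -
  have *: "real (length (chain \<mu> prot tr)) \<le> slots" if "tr \<in> set_pmf (execution prot \<sigma>)" for tr
    using length_chain_le[of \<mu> prot tr] length_trace[OF that] by simp
  have "expect \<sigma> (\<lambda>tr. real (length (chain \<mu> prot tr))) \<le> expect \<sigma> (\<lambda>tr. slots)"
    using * by (intro expectation_pmf_mono integrable_pmf_bounded[where K = slots]) auto
  then show ?thesis by (simp add: sum_blocks)
qed

section \<open>The exchange rate and bounds on the utilities\<close>

lemma rate_bounds: "x_min \<le> rate tr" "rate tr \<le> x_max"
  using constants by (auto simp: rate_def)

text \<open>The rate takes only two values, so it exceeds \<open>x_min\<close> only where the attack
  fails, and there replacing it by \<open>x_min\<close> costs at most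
  \<open>K * (x_max - x_min)\<close>. In use, \<open>f\<close> is the stake or the ledger
  reward.\<close>

lemma expect_rate:
  assumes f: "\<And>tr. tr \<in> set_pmf (execution prot \<sigma>) \<Longrightarrow> 0 \<le> f tr \<and> f tr \<le> K"
  shows "expect \<sigma> f * x_min \<le> expect \<sigma> (\<lambda>tr. f tr * rate tr)" (is "?lower")
    and "expect \<sigma> (\<lambda>tr. f tr * rate tr)
      \<le> expect \<sigma> f * x_min + K * (x_max - x_min) * prob \<sigma> (\<lambda>tr. rate tr \<noteq> x_min)" (is "?upper")
proof -
  let ?D = "execution prot \<sigma>" and ?I = "indicator {tr. rate tr \<noteq> x_min} :: _ \<Rightarrow> real"
  have int_f: "integrable ?D f"
    using f by (intro integrable_pmf_bounded[where K = K]) auto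
  have int: "integrable ?D (\<lambda>tr. f tr * rate tr)"
  proof (rule integrable_pmf_bounded[where K = "K * x_max"])
    fix tr assume tr: "tr \<in> set_pmf ?D"
    have "0 \<le> rate tr" using rate_bounds(1)[of tr] constants by simp
    then show "\<bar>f tr * rate tr\<bar> \<le> K * x_max"
      using f[OF tr] rate_bounds(2)[of tr] by (auto simp: abs_mult intro!: mult_mono)
  qed
  have "expect \<sigma> (\<lambda>tr. f tr * x_min) \<le> expect \<sigma> (\<lambda>tr. f tr * rate tr)"
    using int int_f f rate_bounds(1) by (intro expectation_pmf_mono) (auto intro: mult_left_mono)
  then show ?lower by simp
  have int_I: "integrable ?D ?I"
    by (rule integrable_pmf_bounded[where K = 1]) (simp add: indicator_def)
  have "expect \<sigma> (\<lambda>tr. f tr * rate tr) \<le> expect \<sigma> (\<lambda>tr. f tr * x_min + K * (x_max - x_min) * ?I tr)"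
  proof (rule expectation_pmf_mono[OF int])
    show "integrable ?D (\<lambda>tr. f tr * x_min + K * (x_max - x_min) * ?I tr)"
      using int_f int_I by (intro Bochner_Integration.integrable_add integrable_mult_left integrable_mult_right)
    fix tr assume tr: "tr \<in> set_pmf ?D"
    show "f tr * rate tr \<le> f tr * x_min + K * (x_max - x_min) * ?I tr"
    proof (cases "rate tr = x_min")
      case False
      then have "rate tr = x_max" by (auto simp: rate_def split: if_splits)
      moreover have "f tr * (x_max - x_min) \<le> K * (x_max - x_min)"
        using f[OF tr] constants by (intro mult_right_mono) auto
      ultimately show ?thesis using False by (simp add: algebra_simps)
    qed simp
  qed
  also have "\<dots> = expect \<sigma> f * x_min + K * (x_max - x_min) * prob \<sigma> (\<lambda>tr. rate tr \<noteq> x_min)"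
    using int_f int_I by (subst Bochner_Integration.integral_add) auto
  finally show ?upper .
qed

lemma util_eq:
  "util P \<sigma> = expect \<sigma> (\<lambda>tr. \<mu> P * stake * rate tr) + expect \<sigma> (\<lambda>tr. ledger_reward \<mu> prot R P tr * rate tr)
     + \<beta> P * prob \<sigma> (\<lambda>tr. IP tr P)"
proof -
  have "expect \<sigma> (\<lambda>tr. if IP tr P then \<beta> P else 0) = expect \<sigma> (\<lambda>tr. \<beta> P * indicator {tr. IP tr P} tr)"
    by (intro Bochner_Integration.integral_cong) (auto simp: indicator_def)
  then show ?thesis by (simp add: utility reward_utility_def rate_def)
qed

lemma expect_ledger_reward: "expect \<sigma> (ledger_reward \<mu> prot R P) = R * blocks P \<sigma>"
  unfolding ledger_reward_def blocks_def by simp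

lemma ledger_reward_bounds:
  assumes "tr \<in> set_pmf (execution prot \<sigma>)"
  shows "0 \<le> ledger_reward \<mu> prot R P tr \<and> ledger_reward \<mu> prot R P tr \<le> slots * R"
  using blocks_created_le_slots[OF assms] constants by (auto simp: ledger_reward_def intro: mult_right_mono)

lemma stake_nonneg: "0 \<le> \<mu> P * stake"
  using power constants by simp

lemma util_ge: "(\<mu> P * stake + R * blocks P \<sigma>) * x_min + \<beta> P * prob \<sigma> (\<lambda>tr. IP tr P) \<le> util P \<sigma>"
  using expect_rate(1)[of \<sigma> "\<lambda>tr. \<mu> P * stake" "\<mu> P * stake"] stake_nonneg[of P]
    expect_rate(1)[of \<sigma> "ledger_reward \<mu> prot R P", OF ledger_reward_bounds[where \<sigma> = \<sigma>]]
  by (simp add: util_eq expect_ledger_reward distrib_right)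

lemma util_ge_bribe: "\<beta> P * prob \<sigma> (\<lambda>tr. IP tr P) \<le> util P \<sigma>"
proof -
  have "0 \<le> (\<mu> P * stake + R * blocks P \<sigma>) * x_min"
    using stake_nonneg[of P] constants blocks_nonneg[of P \<sigma>] by simp
  then show ?thesis using util_ge[of P \<sigma>] by linarith
qed

lemma util_nonneg: "0 \<le> util P \<sigma>"
proof -
  have "0 \<le> \<beta> P * prob \<sigma> (\<lambda>tr. IP tr P)" using bribes by simp
  then show ?thesis using util_ge_bribe[of P \<sigma>] by linarith
qed

text \<open>The main term is that of \<open>util_ge\<close>, so the two bounds differ only by the
  gain from a failing attack and by the chance of missing the bribe. The equilibrium proofs play
  them off against each other.\<close>

lemma util_le:
  assumes p: "prob \<sigma> (\<lambda>tr. rate tr \<noteq> x_min) \<le> p"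
  shows "util P \<sigma> \<le> (\<mu> P * stake + R * blocks P \<sigma>) * x_min
    + (\<mu> P * stake + slots * R) * (x_max - x_min) * p + \<beta> P"
proof -
  have "util P \<sigma> \<le> (\<mu> P * stake + R * blocks P \<sigma>) * x_min
    + (\<mu> P * stake + slots * R) * (x_max - x_min) * prob \<sigma> (\<lambda>tr. rate tr \<noteq> x_min)
    + \<beta> P * prob \<sigma> (\<lambda>tr. IP tr P)"
    using expect_rate(2)[of \<sigma> "\<lambda>tr. \<mu> P * stake" "\<mu> P * stake"] stake_nonneg[of P]
      expect_rate(2)[of \<sigma> "ledger_reward \<mu> prot R P", OF ledger_reward_bounds[where \<sigma> = \<sigma>]]
    by (simp add: util_eq expect_ledger_reward distrib_right)
  moreover have "(\<mu> P * stake + slots * R) * (x_max - x_min) * prob \<sigma> (\<lambda>tr. rate tr \<noteq> x_min)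
      \<le> (\<mu> P * stake + slots * R) * (x_max - x_min) * p"
    using p stake_nonneg[of P] constants by (intro mult_left_mono) auto
  moreover have "\<beta> P * prob \<sigma> (\<lambda>tr. IP tr P) \<le> \<beta> P"
    using bribes[of P] by (simp add: mult_left_le)
  ultimately show ?thesis by linarith
qed

section \<open>The honest profile, and block counts under universal infraction\<close>

lemma honest_profile_in: "honest_profile prot \<in> profiles S"
  using strategies by (simp add: honest_profile_def profiles_def)

lemma S_IP_profile_in: "(\<lambda>P. S_IP) \<in> profiles S"
  using strategies by (simp add: profiles_def)

lemma length_honest_chain:
  assumes "tr \<in> set_pmf (execution prot (honest_profile prot))"
  shows "length (chain \<mu> prot tr) = num_slots prot"
proof -
  have "map bslot (chain \<mu> prot tr) = [0..<num_slots prot]"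
    using standing[unfolded standing_assumptions_def, THEN conjunct2, THEN conjunct1] assms by blast
  then have "length (map bslot (chain \<mu> prot tr)) = length [0..<num_slots prot]" by simp
  then show ?thesis by simp
qed

text \<open>Nobody commits an infraction, so the offending power is 0 < \<alpha> and the rate is
  \<open>x_max\<close>; every slot contributes one block to the chain.\<close>

lemma welfare_honest: "welfare util (honest_profile prot) = (stake + slots * R) * x_max"
proof -
  let ?h = "honest_profile prot"
  have no_IP: "\<not> IP tr P" if "tr \<in> set_pmf (execution prot ?h)" for tr P
    using infraction honest_profile_in that unfolding infraction_predicate_def
    by (auto simp: honest_profile_def)
  have AE: "AE tr in execution prot ?h. rate tr = x_max \<and> (\<forall>P. \<not> IP tr P)"
    unfolding AE_measure_pmf_iff using no_IP threshold by (simp add: rate_def)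
  have "util P ?h = (\<mu> P * stake + R * blocks P ?h) * x_max" for P
  proof -
    have "expect ?h (\<lambda>tr. \<mu> P * stake * rate tr) = expect ?h (\<lambda>tr. \<mu> P * stake * x_max)"
      "expect ?h (\<lambda>tr. ledger_reward \<mu> prot R P tr * rate tr) = expect ?h (\<lambda>tr. ledger_reward \<mu> prot R P tr * x_max)"
      using AE by (intro integral_cong_AE; auto)+
    moreover have "prob ?h (\<lambda>tr. IP tr P) = 0"
      using AE by (subst measure_pmf.prob_eq_0) auto
    ultimately show ?thesis by (simp add: util_eq expect_ledger_reward distrib_right)
  qed
  moreover have "(\<Sum>P\<in>UNIV. blocks P ?h) = slots"
  proof -
    have "expect ?h (\<lambda>tr. real (length (chain \<mu> prot tr))) = expect ?h (\<lambda>tr. slots)"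
      using length_honest_chain by (intro integral_cong_AE) (auto simp: AE_measure_pmf_iff)
    then show ?thesis by (simp add: sum_blocks)
  qed
  ultimately show ?thesis
    by (simp add: welfare_def sum.distrib power flip: sum_distrib_left sum_distrib_right)
qed

text \<open>Each possible list of elections also occurs in an honest execution, where the chain is
  full.\<close>

lemma quorum_committee:
  assumes "e \<in> set_pmf (elections prot)" "(l, C) \<in> set e"
  shows "quorum prot C < sum \<mu> C"
proof -
  have "e \<in> set_pmf (map_pmf elected (execution prot (honest_profile prot)))"
    using assms by (simp only: map_elected_execution)
  then obtain tr where tr: "tr \<in> set_pmf (execution prot (honest_profile prot))" "e = elected tr" by auto
  have "length (chain \<mu> prot tr) = length tr"
    using length_honest_chain[OF tr(1)] length_trace[OF tr(1)] by simp
  then show ?thesis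
    by (rule quorum_if_full_chain[OF power(1)]) (use assms(2) tr(2) in simp)
qed

text \<open>The number of slots led by \<open>P\<close> bounds its blocks under every profile, has
  the same expectation under all profiles, and is attained when everybody plays
  \<open>S_IP\<close>.\<close>

lemma blocks_le_infraction: "blocks P \<sigma> \<le> blocks P (\<lambda>P. S_IP)"
proof -
  have le: "real (lead_slots P (elected tr)) \<le> slots" if "tr \<in> set_pmf (execution prot \<sigma>)" for tr \<sigma>
    using length_filter_le[of "\<lambda>lC. fst lC = P" "elected tr"] length_trace[OF that]
    by (simp add: lead_slots_def elected_def)
  have "blocks P \<sigma> \<le> expect \<sigma> (\<lambda>tr. real (lead_slots P (elected tr)))"
    unfolding blocks_def using le blocks_created_le_lead_slots[OF protocol]
    by (intro expectation_pmf_mono integrable_blocks integrable_pmf_bounded[where K = slots]) auto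
  also have "\<dots> = expect (\<lambda>P. S_IP) (\<lambda>tr. real (lead_slots P (elected tr)))"
    by (simp only: expectation_execution_elected[where f = "\<lambda>e. real (lead_slots P e)"])
  also have "\<dots> = blocks P (\<lambda>P. S_IP)"
    unfolding blocks_def
  proof (rule integral_cong_AE)
    show "AE tr in execution prot (\<lambda>P. S_IP). real (lead_slots P (elected tr)) = real (blocks_created \<mu> prot P tr)"
      unfolding AE_measure_pmf_iff
    proof
      fix tr assume "tr \<in> set_pmf (execution prot (\<lambda>P. S_IP))"
      then obtain e \<rho> where e: "e \<in> set_pmf (elections prot)" "tr = run \<rho> (\<lambda>P. S_IP) [] e"
        by (auto simp: set_pmf_execution)
      have "blocks_created \<mu> prot P tr = lead_slots P e"
        unfolding e(2) using quorum_committee[OF e(1)] ledger_protocolD(1)[OF protocol e(1)]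
        by (intro blocks_created_infraction[OF protocol strategy_IP]) simp_all
      then show "real (lead_slots P (elected tr)) = real (blocks_created \<mu> prot P tr)"
        by (simp add: elected_run e(2))
    qed
  qed auto
  finally show ?thesis .
qed

text \<open>What \<open>S_IP\<close> and \<open>premature\<close> have in common; the estimates on
  bribes and on the success of the attack are proved from it once for both.\<close>

definition reliable :: "('p, 'd, 'c) strategy \<Rightarrow> bool" where
  "reliable s \<longleftrightarrow> s \<in> S \<and> (\<forall>\<sigma>\<in>profiles S. \<forall>P. \<sigma> P = s \<longrightarrow> prob \<sigma> (\<lambda>tr. \<not> double_signs prot \<Delta> tr P) \<le> \<delta>)"

lemma reliable_S_IP: "reliable S_IP"
  using frame strategies by (simp add: reliable_def)

text \<open>The bound \<delta>, assumed for \<open>S_IP\<close> only, carries over: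
  \<open>S_IP\<close> cannot double sign without being elected in the time frame, so having no turn
  has probability at most \<delta>, while \<open>premature\<close> double signs whenever it has a
  turn.\<close>

lemma reliable_premature:
  assumes "premature d \<in> S" "(q::'p) \<noteq> q'"
  shows "reliable (premature d)"
  unfolding reliable_def
proof (intro conjI ballI allI impI)
  fix \<sigma> :: "('p, 'd, 'c) profile" and P
  assume \<sigma>: "\<sigma> \<in> profiles S" "\<sigma> P = premature d"
  have "prob \<sigma> (\<lambda>tr. \<not> double_signs prot \<Delta> tr P) \<le> prob \<sigma> (\<lambda>tr. \<not> has_turn \<Delta> P (elected tr))"
  proof (rule measure_pmf.finite_measure_mono_AE)
    show "AE tr in execution prot \<sigma>. tr \<in> {tr. \<not> double_signs prot \<Delta> tr P} \<longrightarrow>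
        tr \<in> {tr. \<not> has_turn \<Delta> P (elected tr)}"
      using double_signs_premature[where \<sigma> = \<sigma> and P = P and d = d and prot = prot and \<Delta> = \<Delta>,
          OF _ \<sigma>(2) assms(2)]
      unfolding AE_measure_pmf_iff set_pmf_execution by (auto simp: elected_run)
  qed simp
  also have "\<dots> = prob (\<lambda>P. S_IP) (\<lambda>tr. \<not> has_turn \<Delta> P (elected tr))"
    by (simp only: prob_execution_elected[where A = "\<lambda>e. \<not> has_turn \<Delta> P e"])
  also have "\<dots> \<le> prob (\<lambda>P. S_IP) (\<lambda>tr. \<not> double_signs prot \<Delta> tr P)"
    by (intro measure_pmf.finite_measure_mono) (auto dest: has_turn_if_double_signs)
  also have "\<dots> \<le> \<delta>"
    by (rule frame[OF S_IP_profile_in refl])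
  finally show "prob \<sigma> (\<lambda>tr. \<not> double_signs prot \<Delta> tr P) \<le> \<delta>" .
qed (rule assms(1))

lemma delta_nonneg: "0 \<le> \<delta>"
  using frame[OF S_IP_profile_in refl] measure_nonneg order_trans by blast

lemma prob_IP:
  assumes "reliable s" "\<sigma> \<in> profiles S" "\<sigma> P = s"
  shows "1 - \<delta> \<le> prob \<sigma> (\<lambda>tr. IP tr P)"
proof -
  have "prob \<sigma> (\<lambda>tr. \<not> IP tr P) = 1 - prob \<sigma> (\<lambda>tr. IP tr P)"
    using measure_pmf.prob_compl[of "{tr. IP tr P}" "execution prot \<sigma>"]
    by (simp add: Compl_eq_Diff_UNIV[symmetric] Collect_neg_eq)
  moreover have "prob \<sigma> (\<lambda>tr. \<not> IP tr P) \<le> prob \<sigma> (\<lambda>tr. \<not> double_signs prot \<Delta> tr P)"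
    using infraction assms(2) unfolding infraction_predicate_def
    by (intro measure_pmf.finite_measure_mono_AE) (auto simp: AE_measure_pmf_iff)
  moreover have "prob \<sigma> (\<lambda>tr. \<not> double_signs prot \<Delta> tr P) \<le> \<delta>" using assms by (simp add: reliable_def)
  ultimately show ?thesis by linarith
qed

text \<open>The others together have power 1 - \<open>\<mu> P\<close> \<ge> \<alpha>. If all of them
  double sign, the rate is \<open>x_min\<close> whatever \<open>P\<close> does; a union bound over
  the others gives the probability.\<close>

lemma prob_attack_fails:
  assumes s: "reliable s" and \<sigma>: "\<sigma> \<in> profiles S" "\<And>Q. Q \<noteq> P \<Longrightarrow> \<sigma> Q = s" and P: "\<mu> P \<le> 1 - \<alpha>"
  shows "prob \<sigma> (\<lambda>tr. rate tr \<noteq> x_min) \<le> real (CARD('p)) * \<delta>"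
proof -
  have "prob \<sigma> (\<lambda>tr. rate tr \<noteq> x_min) \<le> prob \<sigma> (\<lambda>tr. \<exists>Q\<in>-{P}. \<not> double_signs prot \<Delta> tr Q)"
  proof (rule measure_pmf.finite_measure_mono_AE)
    have "rate tr = x_min" if tr: "tr \<in> set_pmf (execution prot \<sigma>)"
      and ds: "\<forall>Q\<in>-{P}. double_signs prot \<Delta> tr Q" for tr
    proof -
      have "- {P} \<subseteq> {Q. IP tr Q}"
        using infraction \<sigma>(1) tr ds unfolding infraction_predicate_def by blast
      then have "sum \<mu> (- {P}) \<le> (\<Sum>Q | IP tr Q. \<mu> Q)"
        by (intro sum_mono2) (auto simp: power)
      moreover have "sum \<mu> (- {P}) = 1 - \<mu> P"
        using power(2) by (simp add: Compl_eq_Diff_UNIV sum_diff1)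
      ultimately show ?thesis using P by (simp add: rate_def)
    qed
    then show "AE tr in execution prot \<sigma>. tr \<in> {tr. rate tr \<noteq> x_min} \<longrightarrow>
        tr \<in> {tr. \<exists>Q\<in>-{P}. \<not> double_signs prot \<Delta> tr Q}"
      unfolding AE_measure_pmf_iff by blast
  qed simp
  also have "{tr. \<exists>Q\<in>-{P}. \<not> double_signs prot \<Delta> tr Q} = (\<Union>Q\<in>-{P}. {tr. \<not> double_signs prot \<Delta> tr Q})"
    by auto
  also have "measure_pmf.prob (execution prot \<sigma>) \<dots> \<le> (\<Sum>Q\<in>-{P}. prob \<sigma> (\<lambda>tr. \<not> double_signs prot \<Delta> tr Q))"
    by (intro measure_pmf.finite_measure_subadditive_finite) auto
  also have "\<dots> \<le> (\<Sum>Q\<in>-{P}. \<delta>)"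
    using s \<sigma> by (intro sum_mono) (simp add: reliable_def)
  \<comment> \<open>Counting \<open>P\<close> as well gives a constant that does not mention the
    deviator.\<close>
  also have "\<dots> \<le> (\<Sum>Q\<in>(UNIV::'p set). \<delta>)"
    using delta_nonneg by (intro sum_mono2) auto
  finally show ?thesis by simp
qed

text \<open>The chain stays empty unless \<open>P\<close> is a quorum on its own in some slot; in
  that event the number of slots is a crude bound.\<close>

lemma blocks_premature:
  assumes "\<And>Q. Q \<noteq> P \<Longrightarrow> \<sigma> Q = premature d"
  shows "blocks P \<sigma> \<le> slots * prob_sole_quorum \<mu> prot P"
proof -
  define sole where "sole e \<longleftrightarrow> (\<exists>(l, C)\<in>set e. P \<in> C \<and> quorum prot C < \<mu> P)" for e :: "('p \<times> 'p set) list"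
  have "blocks P \<sigma> \<le> expect \<sigma> (\<lambda>tr. slots * indicator {tr. sole (elected tr)} tr)"
    unfolding blocks_def
  proof (rule expectation_pmf_mono[OF integrable_blocks])
    fix tr assume tr: "tr \<in> set_pmf (execution prot \<sigma>)"
    show "real (blocks_created \<mu> prot P tr) \<le> slots * indicator {tr. sole (elected tr)} tr"
    proof (cases "sole (elected tr)")
      case True
      then show ?thesis using blocks_created_le_slots[OF tr] by simp
    next
      case False
      obtain e \<rho> where e: "tr = run \<rho> \<sigma> [] e" using tr by (auto simp: set_pmf_execution)
      have "\<mu> P \<le> quorum prot C" if "(l, C) \<in> set e" "P \<in> C" for l C
        using False that unfolding sole_def e elected_run by (auto simp: not_less)
      then have "chain \<mu> prot tr = []"
        unfolding e by (intro chain_premature[OF protocol assms])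
      then show ?thesis by (simp add: blocks_created_def)
    qed
  qed (rule integrable_pmf_bounded[where K = slots], simp add: indicator_def)
  also have "\<dots> = slots * prob_sole_quorum \<mu> prot P"
    using prob_execution_elected[of prot \<sigma> sole]
    by (simp add: prob_sole_quorum_def sole_def)
  finally show ?thesis .
qed

section \<open>Equilibria, their welfare, and finiteness of the price\<close>

lemma deviation_in:
  assumes "\<sigma> \<in> profiles S" "s \<in> S"
  shows "\<sigma>(P := s) \<in> profiles S"
  using assms by (simp add: profiles_def)

lemma welfare_nonneg: "0 \<le> welfare util \<sigma>"
  by (simp add: welfare_def sum_nonneg util_nonneg)

lemma welfare_le:
  assumes "prob \<sigma> (\<lambda>tr. rate tr \<noteq> x_min) \<le> p"
  shows "welfare util \<sigma> \<le> (stake + R * (\<Sum>P\<in>UNIV. blocks P \<sigma>)) * x_min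
    + (stake + CARD('p) * (slots * R)) * (x_max - x_min) * p + (\<Sum>P\<in>UNIV. \<beta> P)"
proof -
  have "welfare util \<sigma> \<le> (\<Sum>P\<in>UNIV. (\<mu> P * stake + R * blocks P \<sigma>) * x_min
      + (\<mu> P * stake + slots * R) * (x_max - x_min) * p + \<beta> P)"
    unfolding welfare_def by (intro sum_mono util_le assms)
  also have "\<dots> = (stake + R * (\<Sum>P\<in>UNIV. blocks P \<sigma>)) * x_min
    + (stake + CARD('p) * (slots * R)) * (x_max - x_min) * p + (\<Sum>P\<in>UNIV. \<beta> P)"
    by (simp add: sum.distrib power flip: sum_distrib_left sum_distrib_right)
  finally show ?thesis .
qed

lemma sum_bribes_nonneg: "0 \<le> (\<Sum>P\<in>UNIV. \<beta> P)"
  using bribes by (simp add: sum_nonneg)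

lemma bribe_le_sum: "\<beta> P \<le> (\<Sum>P\<in>UNIV. \<beta> P)"
  using bribes by (intro member_le_sum) auto

lemma stake_le: "\<mu> P * stake \<le> stake"
proof -
  have "\<mu> P \<le> (\<Sum>P\<in>UNIV. \<mu> P)" using power(1) by (intro member_le_sum) auto
  then show ?thesis using power(2) constants by (simp add: mult_left_le_one_le)
qed

lemma attack_loss_le:
  "(\<mu> P * stake + slots * R) * (x_max - x_min) * (CARD('p) * \<delta>)
    \<le> (stake + slots * R) * (x_max - x_min) * (CARD('p) * \<delta>)"
  using stake_le constants delta_nonneg by (intro mult_right_mono) auto

text \<open>A deviation neither creates more blocks nor earns more than the full bribe. What remains
  to be tolerated is the gain when the attack fails, and the bribe that \<open>S_IP\<close> misses
  with probability at most \<delta>.\<close>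

lemma equilibrium_infraction:
  assumes "\<And>P. \<mu> P \<le> 1 - \<alpha>"
    and \<epsilon>: "(stake + slots * R) * (x_max - x_min) * (CARD('p) * \<delta>) + (\<Sum>P\<in>UNIV. \<beta> P) * \<delta> \<le> \<epsilon>"
  shows "nash_equilibrium S util \<epsilon> (\<lambda>P. S_IP)"
  unfolding nash_equilibrium_def
proof (intro conjI allI ballI)
  fix P :: 'p and s assume s: "s \<in> S - {S_IP}"
  let ?\<sigma> = "(\<lambda>P. S_IP)(P := s)"
  have "prob ?\<sigma> (\<lambda>tr. rate tr \<noteq> x_min) \<le> real CARD('p) * \<delta>"
    by (rule prob_attack_fails[OF reliable_S_IP deviation_in[OF S_IP_profile_in], of _ P])
       (use s assms in auto)
  from util_le[OF this, of P]
  have "util P ?\<sigma> \<le> (\<mu> P * stake + R * blocks P ?\<sigma>) * x_min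
      + (stake + slots * R) * (x_max - x_min) * (CARD('p) * \<delta>) + \<beta> P"
    using attack_loss_le[of P] by linarith
  also have "(\<mu> P * stake + R * blocks P ?\<sigma>) * x_min
      \<le> (\<mu> P * stake + R * blocks P (\<lambda>P. S_IP)) * x_min"
    using constants blocks_le_infraction by (intro mult_right_mono add_left_mono mult_left_mono) auto
  finally have dev: "util P ?\<sigma> \<le> (\<mu> P * stake + R * blocks P (\<lambda>P. S_IP)) * x_min
      + (stake + slots * R) * (x_max - x_min) * (CARD('p) * \<delta>) + \<beta> P" by simp
  have "\<beta> P * (1 - \<delta>) \<le> \<beta> P * prob (\<lambda>P. S_IP) (\<lambda>tr. IP tr P)"
    using prob_IP[OF reliable_S_IP S_IP_profile_in] bribes by (intro mult_left_mono) auto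
  then have "(\<mu> P * stake + R * blocks P (\<lambda>P. S_IP)) * x_min + (\<beta> P - \<beta> P * \<delta>) \<le> util P (\<lambda>P. S_IP)"
    using util_ge[of P "\<lambda>P. S_IP"] by (simp add: right_diff_distrib)
  moreover have "\<beta> P * \<delta> \<le> (\<Sum>P\<in>UNIV. \<beta> P) * \<delta>"
    using bribe_le_sum delta_nonneg by (intro mult_right_mono)
  ultimately show "util P ?\<sigma> - \<epsilon> \<le> util P (\<lambda>P. S_IP)"
    using dev \<epsilon> by linarith
qed (rule S_IP_profile_in)

lemma welfare_infraction:
  assumes "\<And>P. \<mu> P \<le> 1 - \<alpha>"
  shows "welfare util (\<lambda>P. S_IP) \<le> (stake + slots * R) * (x_min + (CARD('p))\<^sup>2 * (x_max - x_min) * \<delta>)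
    + (\<Sum>P\<in>UNIV. \<beta> P)"
proof -
  have "prob (\<lambda>P. S_IP) (\<lambda>tr. rate tr \<noteq> x_min) \<le> real CARD('p) * \<delta>"
    by (rule prob_attack_fails[OF reliable_S_IP S_IP_profile_in]) (use assms in auto)
  note welfare_le[OF this]
  also have "(stake + R * (\<Sum>P\<in>UNIV. blocks P (\<lambda>P. S_IP))) * x_min \<le> (stake + slots * R) * x_min"
    using constants sum_blocks_le[of "\<lambda>P. S_IP"]
    by (intro mult_right_mono add_left_mono) (auto simp: mult.commute intro: mult_left_mono)
  \<comment> \<open>One factor \<open>CARD('p)\<close> is that of the union bound, the other comes
    from bounding each party's rewards by those of all slots. The stake is multiplied as well so
    that \<open>stake + slots * R\<close> factors out.\<close>
  also have "(stake + CARD('p) * (slots * R)) * (x_max - x_min) * (CARD('p) * \<delta>)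
      \<le> (CARD('p) * (stake + slots * R)) * (x_max - x_min) * (CARD('p) * \<delta>)"
  proof -
    have "1 * stake \<le> CARD('p) * stake"
      using constants by (intro mult_right_mono) (auto simp: Suc_le_eq)
    then show ?thesis
      using constants delta_nonneg by (intro mult_right_mono) (auto simp: distrib_left)
  qed
  finally show ?thesis by (simp add: power2_eq_square algebra_simps)
qed

lemma premature_profile_in: "premature d \<in> S \<Longrightarrow> (\<lambda>P. premature d) \<in> profiles S"
  by (simp add: profiles_def)

lemma block_reward_premature:
  assumes "\<And>Q. Q \<noteq> P \<Longrightarrow> \<sigma> Q = premature d"
  shows "R * blocks P \<sigma> * x_min \<le> slots * R * x_min * prob_sole_quorum \<mu> prot P"
proof -
  have "(R * x_min) * blocks P \<sigma> \<le> (R * x_min) * (slots * prob_sole_quorum \<mu> prot P)"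
    using blocks_premature[OF assms] constants by (intro mult_left_mono) auto
  then show ?thesis by (simp add: mult_ac)
qed

lemma sole_quorum_le_sum: "prob_sole_quorum \<mu> prot P \<le> (\<Sum>P\<in>UNIV. prob_sole_quorum \<mu> prot P)"
  by (intro member_le_sum) (auto simp: prob_sole_quorum_def)

text \<open>A deviator keeps its stake at about \<open>x_min\<close> and finds block rewards only as
  a sole quorum. The entire sum of bribes is put into the tolerance, so no bribe has to be credited
  to the equilibrium.\<close>

lemma equilibrium_premature:
  assumes d: "premature d \<in> S" and q: "(q::'p) \<noteq> q'" and \<mu>: "\<And>P. \<mu> P \<le> 1 - \<alpha>"
    and \<epsilon>: "slots * R * x_min * (\<Sum>P\<in>UNIV. prob_sole_quorum \<mu> prot P)
      + (stake + slots * R) * (x_max - x_min) * (CARD('p) * \<delta>) + (\<Sum>P\<in>UNIV. \<beta> P) \<le> \<epsilon>"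
  shows "nash_equilibrium S util \<epsilon> (\<lambda>P. premature d)"
  unfolding nash_equilibrium_def
proof (intro conjI allI ballI)
  fix P :: 'p and s assume s: "s \<in> S - {premature d}"
  let ?\<sigma> = "(\<lambda>P. premature d)(P := s)"
  have "prob ?\<sigma> (\<lambda>tr. rate tr \<noteq> x_min) \<le> real CARD('p) * \<delta>"
    by (rule prob_attack_fails[OF reliable_premature[OF d q] deviation_in[OF premature_profile_in[OF d]], of _ P])
       (use s \<mu> in auto)
  from util_le[OF this, of P]
  have "util P ?\<sigma> \<le> \<mu> P * stake * x_min + R * blocks P ?\<sigma> * x_min
      + (stake + slots * R) * (x_max - x_min) * (CARD('p) * \<delta>) + \<beta> P"
    using attack_loss_le[of P] by (simp add: distrib_right)
  moreover have "R * blocks P ?\<sigma> * x_min \<le> slots * R * x_min * prob_sole_quorum \<mu> prot P"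
    by (rule block_reward_premature) simp
  moreover have "slots * R * x_min * prob_sole_quorum \<mu> prot P
      \<le> slots * R * x_min * (\<Sum>P\<in>UNIV. prob_sole_quorum \<mu> prot P)"
    using sole_quorum_le_sum constants by (intro mult_left_mono) auto
  moreover have "\<mu> P * stake * x_min \<le> util P (\<lambda>P. premature d)"
  proof -
    have "0 \<le> R * blocks P (\<lambda>P. premature d) * x_min"
      "0 \<le> \<beta> P * prob (\<lambda>P. premature d) (\<lambda>tr. IP tr P)"
      using constants blocks_nonneg bribes by auto
    then show ?thesis using util_ge[of P "\<lambda>P. premature d"] by (simp add: distrib_right)
  qed
  ultimately show "util P ?\<sigma> - \<epsilon> \<le> util P (\<lambda>P. premature d)"
    using \<epsilon> bribe_le_sum[of P] by linarith
qed (rule premature_profile_in[OF d])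

text \<open>Only the stake at rate \<open>x_min\<close> is a main term; the bracket collects what is
  negligible in the application.\<close>

lemma welfare_premature:
  assumes d: "premature d \<in> S" and q: "(q::'p) \<noteq> q'" and \<mu>: "\<And>P. \<mu> P \<le> 1 - \<alpha>"
  shows "welfare util (\<lambda>P. premature d) \<le> stake * x_min
    + (slots * R * x_min * (\<Sum>P\<in>UNIV. prob_sole_quorum \<mu> prot P)
    + (stake + CARD('p) * (slots * R)) * (x_max - x_min) * (CARD('p) * \<delta>) + (\<Sum>P\<in>UNIV. \<beta> P))"
proof -
  have "prob (\<lambda>P. premature d) (\<lambda>tr. rate tr \<noteq> x_min) \<le> real CARD('p) * \<delta>"
    by (rule prob_attack_fails[OF reliable_premature[OF d q] premature_profile_in[OF d]]) (use \<mu> in auto)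
  note welfare_le[OF this]
  moreover have "R * (\<Sum>P\<in>UNIV. blocks P (\<lambda>P. premature d)) * x_min
      \<le> slots * R * x_min * (\<Sum>P\<in>UNIV. prob_sole_quorum \<mu> prot P)"
    unfolding sum_distrib_left sum_distrib_right
    by (intro sum_mono block_reward_premature) simp
  ultimately show ?thesis by (simp add: distrib_right)
qed

text \<open>Against any behaviour of the others, switching to \<open>S_IP\<close> earns the bribe
  except with probability \<delta>, and the other parts of the utility are nonnegative.\<close>

lemma equilibrium_welfare_ge:
  fixes \<epsilon> :: real
  assumes "nash_equilibrium S util \<epsilon> \<sigma>"
  shows "(\<Sum>P\<in>UNIV. \<beta> P) * (1 - \<delta>) - CARD('p) * \<bar>\<epsilon>\<bar> \<le> welfare util \<sigma>"
proof -
  \<comment> \<open>The absolute value covers negative tolerances and the case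
    \<open>\<sigma> P = S_IP\<close>, for which the equilibrium condition says nothing.\<close>
  have "\<beta> P * (1 - \<delta>) - \<bar>\<epsilon>\<bar> \<le> util P \<sigma>" for P
  proof -
    have \<sigma>: "\<sigma> \<in> profiles S" using assms by (simp add: nash_equilibrium_def)
    let ?\<sigma> = "\<sigma>(P := S_IP)"
    have "1 - \<delta> \<le> prob ?\<sigma> (\<lambda>tr. IP tr P)"
      by (rule prob_IP[OF reliable_S_IP deviation_in[OF \<sigma> strategies(2)]]) simp
    then have "\<beta> P * (1 - \<delta>) \<le> \<beta> P * prob ?\<sigma> (\<lambda>tr. IP tr P)"
      using bribes by (intro mult_left_mono)
    also have "\<dots> \<le> util P ?\<sigma>" by (rule util_ge_bribe)
    finally have *: "\<beta> P * (1 - \<delta>) \<le> util P ?\<sigma>" .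
    show ?thesis
    proof (cases "\<sigma> P = S_IP")
      case True
      then have "?\<sigma> = \<sigma>" by auto
      then show ?thesis using * by simp
    next
      case False
      then have "util P ?\<sigma> - \<epsilon> \<le> util P \<sigma>"
        using assms strategies(2) by (auto simp: nash_equilibrium_def)
      then show ?thesis using * by linarith
    qed
  qed
  then have "(\<Sum>P\<in>UNIV. \<beta> P * (1 - \<delta>) - \<bar>\<epsilon>\<bar>) \<le> welfare util \<sigma>"
    unfolding welfare_def by (intro sum_mono)
  then show ?thesis by (simp add: sum_subtractf flip: sum_distrib_right)
qed

lemma price_finite:
  fixes \<epsilon> :: real
  assumes "CARD('p) * \<bar>\<epsilon>\<bar> < (\<Sum>P\<in>UNIV. \<beta> P) * (1 - \<delta>)"
  shows "price_of_anarchy S util \<epsilon> < \<infinity>"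
proof (rule price_of_anarchy_finite)
  fix \<sigma>
  \<comment> \<open>For the supremum any finite bound will do, so the trivial probability is
    inserted.\<close>
  have "prob \<sigma> (\<lambda>tr. rate tr \<noteq> x_min) \<le> 1" by simp
  note welfare_le[OF this]
  also have "(stake + R * (\<Sum>P\<in>UNIV. blocks P \<sigma>)) * x_min \<le> (stake + R * slots) * x_min"
    using constants sum_blocks_le[of \<sigma>] by (intro mult_right_mono add_left_mono mult_left_mono) auto
  finally show "welfare util \<sigma> \<le> (stake + R * slots) * x_min
      + (stake + CARD('p) * (slots * R)) * (x_max - x_min) * 1 + (\<Sum>P\<in>UNIV. \<beta> P)" by simp
next
  show "0 \<le> (stake + R * slots) * x_min
      + (stake + CARD('p) * (slots * R)) * (x_max - x_min) * 1 + (\<Sum>P\<in>UNIV. \<beta> P)"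
    using constants sum_bribes_nonneg by (intro add_nonneg_nonneg mult_nonneg_nonneg) auto
  show "0 < (\<Sum>P\<in>UNIV. \<beta> P) * (1 - \<delta>) - CARD('p) * \<bar>\<epsilon>\<bar>" using assms by simp
qed (rule equilibrium_welfare_ge)

end

text \<open>The lower bounds are claimed for tolerances above some negligible
  \<open>\<epsilon>\<^sub>0\<close>, for which the exhibited profiles are equilibria; finiteness
  holds wherever the bribes exceed an inverse polynomial. In the second claim,
  \<open>\<mu> P \<le> 1 - \<alpha>\<close> lets the attack survive one deviation and the negligible
  \<open>prob_sole_quorum\<close> keeps a lone deviator from earning block rewards; the error \<nu>
  stands in the denominator so that \<open>x_min = 0\<close> is meaningful.\<close>

theorem theorem4:
  fixes \<mu> :: "'p::finite \<Rightarrow> real"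
    and prot :: "nat \<Rightarrow> ('p, 'd, 'c) protocol"
    and S :: "nat \<Rightarrow> ('p, 'd, 'c) strategy set"
    and S_IP :: "nat \<Rightarrow> ('p, 'd, 'c) strategy"
    and \<Delta> :: "nat \<Rightarrow> nat set"
    and IP :: "nat \<Rightarrow> ('p, 'd) trace \<Rightarrow> 'p \<Rightarrow> bool"
    and X :: "nat \<Rightarrow> ('p, 'd, 'c) profile \<Rightarrow> ('p, 'd) trace \<Rightarrow> real"
    and B :: "nat \<Rightarrow> 'p \<Rightarrow> ('p, 'd, 'c) profile \<Rightarrow> ('p, 'd) trace \<Rightarrow> real"
    and U :: "nat \<Rightarrow> 'p \<Rightarrow> ('p, 'd, 'c) profile \<Rightarrow> real"
    and N :: "nat \<Rightarrow> nat"
    and \<beta> :: "nat \<Rightarrow> 'p \<Rightarrow> real"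
    and \<alpha> R total_stake x_max x_min x :: real
  assumes power: "\<And>P. \<mu> P \<in> {0..1}" "(\<Sum>P\<in>UNIV. \<mu> P) = 1"
    and protocol: "\<And>\<kappa>. ledger_protocol \<mu> (prot \<kappa>)"
    and slots: "\<And>\<kappa>. N \<kappa> = num_slots (prot \<kappa>)" "poly_bounded N"
    and space: "strategy_space prot S_IP S"
    and standing: "\<And>\<kappa>. standing_assumptions \<mu> (prot \<kappa>) (S \<kappa>) R"
    and infraction: "\<And>\<kappa>. infraction_predicate (prot \<kappa>) (S \<kappa>) (\<Delta> \<kappa>) (IP \<kappa>)"
    and strategy_IP: "\<And>\<kappa>. infraction_strategy (prot \<kappa>) (S_IP \<kappa>)"
    and frame: "infraction_succeeds prot S \<Delta> S_IP"
    and threshold: "security_threshold \<mu> prot S IP S_IP \<alpha>"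
    and constants: "total_stake > 0" "R \<ge> 0" "x_min \<ge> 0" "x_max > x_min" "x = x_max - x_min"
    and bribes: "\<And>\<kappa> P. \<beta> \<kappa> P \<ge> 0"
    and exchange_rate: "\<And>\<kappa> \<sigma> tr.
          X \<kappa> \<sigma> tr = (if (\<Sum>P | IP \<kappa> tr P. \<mu> P) < \<alpha> then x_max else x_min)"
    and guided_bribing: "\<And>\<kappa> P \<sigma> tr. B \<kappa> P \<sigma> tr = (if IP \<kappa> tr P then \<beta> \<kappa> P else 0)"
    and utility: "\<And>\<kappa> P \<sigma>. U \<kappa> P \<sigma> =
          reward_utility (execution (prot \<kappa>) \<sigma>) (\<mu> P * total_stake)
            (ledger_reward \<mu> (prot \<kappa>) R P) (X \<kappa> \<sigma>) (B \<kappa> P \<sigma>)"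
  shows
    "((\<forall>P. \<mu> P \<le> 1 - \<alpha>) \<and>
      \<not> negl (\<lambda>\<kappa>. \<Sum>P\<in>UNIV. \<beta> \<kappa> P) \<and>
      (\<forall>\<kappa>. (\<Sum>P\<in>UNIV. \<beta> \<kappa> P) \<le> \<alpha> * (real (N \<kappa>) * R + total_stake) * x) \<longrightarrow>
        (\<exists>\<epsilon>\<^sub>0 \<nu>. negl \<epsilon>\<^sub>0 \<and> negl \<nu> \<and>
           (\<forall>\<epsilon>. negl \<epsilon> \<and> (\<forall>\<kappa>. \<epsilon> \<kappa> \<ge> \<epsilon>\<^sub>0 \<kappa>) \<longrightarrow>
              (\<forall>\<^sub>F \<kappa> in sequentially.
                 ereal (1 / (\<alpha> + (1 - \<alpha>) * (x_min / x_max)) - \<nu> \<kappa>)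
                 \<le> price_of_anarchy (S \<kappa>) (U \<kappa>) (\<epsilon> \<kappa>)))) \<and>
        (\<forall>\<epsilon>. negl \<epsilon> \<longrightarrow>
           (\<forall>c::nat. \<forall>\<^sub>F \<kappa> in sequentially.
              (\<Sum>P\<in>UNIV. \<beta> \<kappa> P) \<ge> 1 / real \<kappa> ^ c \<longrightarrow>
              price_of_anarchy (S \<kappa>) (U \<kappa>) (\<epsilon> \<kappa>) < \<infinity>) \<and>
           (\<exists>\<^sub>F \<kappa> in sequentially. price_of_anarchy (S \<kappa>) (U \<kappa>) (\<epsilon> \<kappa>) < \<infinity>)))
     \<and>
     ((\<forall>P. \<mu> P < \<alpha>) \<and>
      negl (\<lambda>\<kappa>. \<Sum>P\<in>UNIV. \<beta> \<kappa> P) \<and>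
      (\<forall>P. \<mu> P \<le> 1 - \<alpha>) \<and>
      (\<forall>P. negl (\<lambda>\<kappa>. prob_sole_quorum \<mu> (prot \<kappa>) P)) \<longrightarrow>
        (\<exists>\<epsilon>\<^sub>0 \<nu>. negl \<epsilon>\<^sub>0 \<and> negl \<nu> \<and> (\<forall>\<kappa>. \<nu> \<kappa> \<ge> 0) \<and>
           (\<forall>\<epsilon>. negl \<epsilon> \<and> (\<forall>\<kappa>. \<epsilon> \<kappa> \<ge> \<epsilon>\<^sub>0 \<kappa>) \<longrightarrow>
              (\<forall>\<^sub>F \<kappa> in sequentially.
                 ereal ((1 + real (N \<kappa>) * R / total_stake) * x_max) / ereal (x_min + \<nu> \<kappa>)
                 \<le> price_of_anarchy (S \<kappa>) (U \<kappa>) (\<epsilon> \<kappa>)))))"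
proof -
  let ?n = "real CARD('p)"
  define b where "b \<kappa> = (\<Sum>P\<in>UNIV. \<beta> \<kappa> P)" for \<kappa>
  obtain \<delta> where \<delta>: "negl \<delta>"
    and frame': "\<And>\<kappa> \<sigma> P. \<sigma> \<in> profiles (S \<kappa>) \<Longrightarrow> \<sigma> P = S_IP \<kappa> \<Longrightarrow>
      measure_pmf.prob (execution (prot \<kappa>) \<sigma>) {tr. \<not> double_signs (prot \<kappa>) (\<Delta> \<kappa>) tr P} \<le> \<delta> \<kappa>"
    using frame unfolding infraction_succeeds_def by blast
  have \<alpha>: "0 < \<alpha>" "\<alpha> < 1" using threshold unfolding security_threshold_def by blast+
  have x: "0 < x" "0 < x_max" using constants by auto
  have X: "X \<kappa> \<sigma> = (\<lambda>tr. if (\<Sum>P | IP \<kappa> tr P. \<mu> P) < \<alpha> then x_max else x_min)" for \<kappa> \<sigma>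
    by (rule ext) (rule exchange_rate)
  have B: "B \<kappa> P \<sigma> = (\<lambda>tr. if IP \<kappa> tr P then \<beta> \<kappa> P else 0)" for \<kappa> P \<sigma>
    by (rule ext) (rule guided_bribing)
  interpret L: bribed_ledger \<mu> "prot \<kappa>" "S \<kappa>" "S_IP \<kappa>" "\<Delta> \<kappa>" "IP \<kappa>" "\<beta> \<kappa>" "U \<kappa>"
    \<alpha> R total_stake x_max x_min "\<delta> \<kappa>" for \<kappa>
  proof
    show "U \<kappa> P \<sigma> = reward_utility (execution (prot \<kappa>) \<sigma>) (\<mu> P * total_stake) (ledger_reward \<mu> (prot \<kappa>) R P)
        (\<lambda>tr. if (\<Sum>P | IP \<kappa> tr P. \<mu> P) < \<alpha> then x_max else x_min) (\<lambda>tr. if IP \<kappa> tr P then \<beta> \<kappa> P else 0)" for P \<sigma>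
      unfolding utility X B ..
  qed (use power protocol space standing infraction strategy_IP frame' \<alpha> constants bribes
        in \<open>auto simp: strategy_space_def\<close>)
  note \<delta>_nonneg = L.delta_nonneg
  have N: "real (num_slots (prot \<kappa>)) = real (N \<kappa>)" for \<kappa> by (simp add: slots)
  have N\<delta>: "negl (\<lambda>\<kappa>. a * (real (N \<kappa>) * \<delta> \<kappa>))" for a
    by (intro negl_cmult negl_mult_poly_bounded \<delta> slots)
  have honest: "(total_stake + real (N \<kappa>) * R) * x_max \<le> welfare (U \<kappa>) (honest_profile (prot \<kappa>))" for \<kappa>
    by (simp add: L.welfare_honest N)
  show ?thesis
  proof (intro conjI impI)
    assume *: "(\<forall>P. \<mu> P \<le> 1 - \<alpha>) \<and> \<not> negl (\<lambda>\<kappa>. \<Sum>P\<in>UNIV. \<beta> \<kappa> P) \<and>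
      (\<forall>\<kappa>. (\<Sum>P\<in>UNIV. \<beta> \<kappa> P) \<le> \<alpha> * (real (N \<kappa>) * R + total_stake) * x)"
    then have \<mu>: "\<mu> P \<le> 1 - \<alpha>" and b_le: "b \<kappa> \<le> \<alpha> * (real (N \<kappa>) * R + total_stake) * x" for P \<kappa>
      by (auto simp: b_def)
    \<comment> \<open>\<open>A\<close> is \<open>x_min + \<alpha> * x\<close>: per unit of stake
      plus maximal rewards, the low rate and the largest admissible bribes. The claimed bound is
      \<open>x_max / A\<close>.\<close>
    define A where "A = \<alpha> * x_max + (1 - \<alpha>) * x_min"
    have A: "0 < A" using \<alpha> x constants by (auto simp: A_def intro: add_pos_nonneg)
    \<comment> \<open>The summand \<open>?n\<close> pays for a failing attack, \<alpha> for missed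
      bribes, whose sum is at most
      \<open>\<alpha> * (real (N \<kappa>) * R + total_stake) * x\<close>.\<close>
    define \<epsilon>\<^sub>0 where "\<epsilon>\<^sub>0 \<kappa> = (total_stake + real (N \<kappa>) * R) * (x * (?n + \<alpha>)) * \<delta> \<kappa>" for \<kappa>
    define y where "y \<kappa> = ?n\<^sup>2 * x * \<delta> \<kappa>" for \<kappa>
    \<comment> \<open>With this choice \<open>x_max / A - \<nu> \<kappa>\<close> is the first-order
      expansion in \<open>y \<kappa>\<close> of \<open>x_max / (A + y \<kappa>)\<close>, and it lies
      below it by convexity.\<close>
    define \<nu> where "\<nu> \<kappa> = x_max * y \<kappa> / A\<^sup>2" for \<kappa>
    have y: "0 \<le> y \<kappa>" for \<kappa> using \<delta>_nonneg[of \<kappa>] x by (simp add: y_def)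
    have "negl (\<lambda>\<kappa>. (total_stake * x * (?n + \<alpha>)) * \<delta> \<kappa> + (R * x * (?n + \<alpha>)) * (real (N \<kappa>) * \<delta> \<kappa>))"
      by (intro negl_add N\<delta> negl_cmult \<delta>)
    then have negl_\<epsilon>\<^sub>0: "negl \<epsilon>\<^sub>0"
      by (rule negl_mono) (simp add: \<epsilon>\<^sub>0_def algebra_simps)
    have "negl (\<lambda>\<kappa>. (x_max * ?n\<^sup>2 * x / A\<^sup>2) * \<delta> \<kappa>)" by (intro negl_cmult \<delta>)
    then have negl_\<nu>: "negl \<nu>" by (rule negl_mono) (simp add: \<nu>_def y_def mult_ac)
    have "ereal (1 / (\<alpha> + (1 - \<alpha>) * (x_min / x_max)) - \<nu> \<kappa>) \<le> price_of_anarchy (S \<kappa>) (U \<kappa>) (\<epsilon> \<kappa>)"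
      if "\<epsilon>\<^sub>0 \<kappa> \<le> \<epsilon> \<kappa>" for \<epsilon> \<kappa>
    proof -
      define T where "T = total_stake + real (N \<kappa>) * R"
      have T: "0 < T" using constants by (simp add: T_def add_pos_nonneg)
      have "b \<kappa> * \<delta> \<kappa> \<le> \<alpha> * T * x * \<delta> \<kappa>"
        using b_le[of \<kappa>] \<delta>_nonneg[of \<kappa>] by (intro mult_right_mono) (simp_all add: T_def add.commute)
      then have "T * x * (?n * \<delta> \<kappa>) + b \<kappa> * \<delta> \<kappa> \<le> \<epsilon>\<^sub>0 \<kappa>"
        unfolding \<epsilon>\<^sub>0_def T_def[symmetric] by (simp add: algebra_simps)
      then have eq: "nash_equilibrium (S \<kappa>) (U \<kappa>) (\<epsilon> \<kappa>) (\<lambda>P. S_IP \<kappa>)"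
        using that \<mu> constants(5) by (intro L.equilibrium_infraction) (simp_all add: N T_def b_def)
      have "welfare (U \<kappa>) (\<lambda>P. S_IP \<kappa>) \<le> T * (x_min + y \<kappa>) + b \<kappa>"
        using L.welfare_infraction[OF \<mu>, of \<kappa>] constants(5) by (simp add: N T_def b_def y_def)
      also have "\<dots> \<le> T * (x_min + y \<kappa>) + \<alpha> * T * x"
        using b_le[of \<kappa>] by (simp add: T_def add.commute)
      also have "\<dots> = T * (A + y \<kappa>)" by (simp add: A_def constants(5) algebra_simps)
      finally have w: "welfare (U \<kappa>) (\<lambda>P. S_IP \<kappa>) \<le> T * (A + y \<kappa>)" .
      have "x_max / A - \<nu> \<kappa> = x_max * (A - y \<kappa>) / A\<^sup>2"
        using A by (simp add: \<nu>_def field_simps power2_eq_square)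
      also have "\<dots> \<le> x_max / (A + y \<kappa>)"
      proof -
        have "(A - y \<kappa>) * (A + y \<kappa>) \<le> A\<^sup>2" by (simp add: power2_eq_square algebra_simps)
        then have "x_max * ((A - y \<kappa>) * (A + y \<kappa>)) \<le> x_max * A\<^sup>2" using x by (intro mult_left_mono) auto
        then show ?thesis using A y[of \<kappa>] by (simp add: field_simps add_pos_nonneg)
      qed
      also have "\<dots> = T * x_max / (T * (A + y \<kappa>))" using T by simp
      finally have "x_max / A - \<nu> \<kappa> \<le> T * x_max / (T * (A + y \<kappa>))" .
      moreover have "1 / (\<alpha> + (1 - \<alpha>) * (x_min / x_max)) = x_max / A"
        using x A by (simp add: A_def field_simps)
      moreover have "T * (A + y \<kappa>) \<noteq> 0" using T A y[of \<kappa>] by simp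
      ultimately have "ereal (1 / (\<alpha> + (1 - \<alpha>) * (x_min / x_max)) - \<nu> \<kappa>)
          \<le> ereal (T * x_max) / ereal (T * (A + y \<kappa>))" by simp
      also have "\<dots> \<le> price_of_anarchy (S \<kappa>) (U \<kappa>) (\<epsilon> \<kappa>)"
        using T x honest[of \<kappa>] eq w L.welfare_nonneg
        by (intro price_of_anarchy_ge[OF L.honest_profile_in]) (simp_all add: T_def)
      finally show ?thesis .
    qed
    then show "\<exists>\<epsilon>\<^sub>0 \<nu>. negl \<epsilon>\<^sub>0 \<and> negl \<nu> \<and>
       (\<forall>\<epsilon>. negl \<epsilon> \<and> (\<forall>\<kappa>. \<epsilon> \<kappa> \<ge> \<epsilon>\<^sub>0 \<kappa>) \<longrightarrow>
          (\<forall>\<^sub>F \<kappa> in sequentially.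
             ereal (1 / (\<alpha> + (1 - \<alpha>) * (x_min / x_max)) - \<nu> \<kappa>)
             \<le> price_of_anarchy (S \<kappa>) (U \<kappa>) (\<epsilon> \<kappa>)))"
      using negl_\<epsilon>\<^sub>0 negl_\<nu> by (intro exI[of _ \<epsilon>\<^sub>0] exI[of _ \<nu>]) simp
    show "\<forall>\<epsilon>. negl \<epsilon> \<longrightarrow>
           (\<forall>c::nat. \<forall>\<^sub>F \<kappa> in sequentially.
              (\<Sum>P\<in>UNIV. \<beta> \<kappa> P) \<ge> 1 / real \<kappa> ^ c \<longrightarrow>
              price_of_anarchy (S \<kappa>) (U \<kappa>) (\<epsilon> \<kappa>) < \<infinity>) \<and>
           (\<exists>\<^sub>F \<kappa> in sequentially. price_of_anarchy (S \<kappa>) (U \<kappa>) (\<epsilon> \<kappa>) < \<infinity>)"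
    proof (intro allI impI conjI)
      fix \<epsilon> :: "nat \<Rightarrow> real" assume "negl \<epsilon>"
      show fin: "\<forall>\<^sub>F \<kappa> in sequentially. (\<Sum>P\<in>UNIV. \<beta> \<kappa> P) \<ge> 1 / real \<kappa> ^ c \<longrightarrow>
          price_of_anarchy (S \<kappa>) (U \<kappa>) (\<epsilon> \<kappa>) < \<infinity>" for c
      proof -
        \<comment> \<open>The extra power supplies a factor \<open>1 / real \<kappa>\<close> \<le>
          1/2, which is at most \<open>1 - \<delta> \<kappa>\<close>.\<close>
        have "\<forall>\<^sub>F \<kappa> in sequentially. \<bar>?n * \<epsilon> \<kappa>\<bar> < 1 / real \<kappa> ^ Suc c"
          "\<forall>\<^sub>F \<kappa> in sequentially. \<bar>\<delta> \<kappa>\<bar> < 1 / real \<kappa> ^ 1"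
          using negl_cmult[OF \<open>negl \<epsilon>\<close>, of ?n] \<delta> unfolding negl_def by blast+
        then show ?thesis
          using eventually_ge_at_top[of 2]
        proof eventually_elim
          case (elim \<kappa>)
          show ?case
          proof
            assume bribe: "1 / real \<kappa> ^ c \<le> (\<Sum>P\<in>UNIV. \<beta> \<kappa> P)"
            have "1 / real \<kappa> \<le> 1 / 2" using elim(3) by (simp add: field_simps)
            then have \<delta>_half: "\<delta> \<kappa> \<le> 1 / 2" using elim(2) by simp
            have "?n * \<bar>\<epsilon> \<kappa>\<bar> < 1 / real \<kappa> ^ Suc c" using elim(1) by (simp add: abs_mult)
            also have "\<dots> = 1 / real \<kappa> ^ c * (1 / real \<kappa>)" by simp
            also have "\<dots> \<le> (\<Sum>P\<in>UNIV. \<beta> \<kappa> P) * (1 - \<delta> \<kappa>)"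
              using bribe \<delta>_half \<open>1 / real \<kappa> \<le> 1 / 2\<close> L.sum_bribes_nonneg by (intro mult_mono) auto
            finally show "price_of_anarchy (S \<kappa>) (U \<kappa>) (\<epsilon> \<kappa>) < \<infinity>" by (rule L.price_finite)
          qed
        qed
      qed
      \<comment> \<open>Sums of bribes that are not negligible exceed one fixed inverse polynomial
        infinitely often.\<close>
      obtain c where "\<not> (\<forall>\<^sub>F \<kappa> in sequentially. \<bar>\<Sum>P\<in>UNIV. \<beta> \<kappa> P\<bar> < 1 / real \<kappa> ^ c)"
        using * unfolding negl_def by blast
      then have "\<exists>\<^sub>F \<kappa> in sequentially. 1 / real \<kappa> ^ c \<le> (\<Sum>P\<in>UNIV. \<beta> \<kappa> P)"
        unfolding frequently_def by (simp add: L.sum_bribes_nonneg not_le)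
      from frequently_eventually_frequently[OF this fin[of c]]
      show "\<exists>\<^sub>F \<kappa> in sequentially. price_of_anarchy (S \<kappa>) (U \<kappa>) (\<epsilon> \<kappa>) < \<infinity>"
        by (rule frequently_elim1) simp
    qed
  next
    assume *: "(\<forall>P. \<mu> P < \<alpha>) \<and> negl (\<lambda>\<kappa>. \<Sum>P\<in>UNIV. \<beta> \<kappa> P) \<and>
      (\<forall>P. \<mu> P \<le> 1 - \<alpha>) \<and> (\<forall>P. negl (\<lambda>\<kappa>. prob_sole_quorum \<mu> (prot \<kappa>) P))"
    define sole where "sole \<kappa> = (\<Sum>P\<in>UNIV. prob_sole_quorum \<mu> (prot \<kappa>) P)" for \<kappa>
    have \<mu>: "\<mu> P \<le> 1 - \<alpha>" for P using * by blast
    have b: "negl b" "\<And>\<kappa>. 0 \<le> b \<kappa>" using * L.sum_bribes_nonneg by (simp_all add: b_def[abs_def])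
    have sole: "negl sole" "\<And>\<kappa>. 0 \<le> sole \<kappa>"
      unfolding sole_def[abs_def] using *
      by (auto intro!: negl_sum sum_nonneg simp: prob_sole_quorum_def)
    \<comment> \<open>A single party would hold all the power, contrary to
      \<open>\<mu> P < \<alpha>\<close> and \<alpha> < 1.\<close>
    obtain q q' :: 'p where q: "q \<noteq> q'"
    proof (rule ccontr)
      assume "\<not> thesis"
      then have UNIV: "(UNIV :: 'p set) = {undefined}" using that by blast
      have "\<mu> undefined = 1" using power(2) unfolding UNIV by simp
      then show False using conjunct1[OF *, THEN spec, of undefined] \<alpha>(2) by simp
    qed
    \<comment> \<open>Any payload works: these blocks conflict by their slot number alone.\<close>
    define d :: 'd where "d = undefined"
    \<comment> \<open>The table has one entry per party, hence is finite and admissible for all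
      large \<kappa>.\<close>
    have premature: "\<forall>\<^sub>F \<kappa> in sequentially. premature d \<in> S \<kappa>"
    proof -
      have "{(1::nat, p::'p, d) | p. True} = (\<lambda>p. (1, p, d)) ` UNIV" by auto
      then have "finite {(1::nat, p::'p, d) | p. True}" by simp
      then show ?thesis using space unfolding premature_def strategy_space_def by blast
    qed
    \<comment> \<open>Chosen to dominate both the tolerance of the equilibrium and the remainder in
      its welfare; the latter requires the factor \<open>?n\<close> at the block rewards.\<close>
    define \<epsilon>\<^sub>0 where "\<epsilon>\<^sub>0 \<kappa> = real (N \<kappa>) * R * x_min * sole \<kappa>
      + (total_stake + ?n * (real (N \<kappa>) * R)) * x * (?n * \<delta> \<kappa>) + b \<kappa>" for \<kappa>
    define \<nu> where "\<nu> \<kappa> = \<epsilon>\<^sub>0 \<kappa> / total_stake" for \<kappa>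
    have "negl (\<lambda>\<kappa>. ((R * x_min) * (real (N \<kappa>) * sole \<kappa>)
        + ((total_stake * x * ?n) * \<delta> \<kappa> + (?n * R * x * ?n) * (real (N \<kappa>) * \<delta> \<kappa>))) + b \<kappa>)"
      by (intro negl_add N\<delta> negl_cmult[OF \<delta>] negl_cmult[OF negl_mult_poly_bounded] sole b slots)
    then have negl_\<epsilon>\<^sub>0: "negl \<epsilon>\<^sub>0" by (rule negl_mono) (simp add: \<epsilon>\<^sub>0_def algebra_simps)
    then have negl_\<nu>: "negl \<nu>"
      using negl_cmult[of \<epsilon>\<^sub>0 "1 / total_stake"] by (simp add: \<nu>_def[abs_def])
    have "0 \<le> \<epsilon>\<^sub>0 \<kappa>" for \<kappa>
      using constants x \<delta>_nonneg[of \<kappa>] sole b by (simp add: \<epsilon>\<^sub>0_def)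
    then have \<nu>: "0 \<le> \<nu> \<kappa>" for \<kappa> using constants by (simp add: \<nu>_def)
    have bound: "ereal ((1 + real (N \<kappa>) * R / total_stake) * x_max) / ereal (x_min + \<nu> \<kappa>)
        \<le> price_of_anarchy (S \<kappa>) (U \<kappa>) (\<epsilon> \<kappa>)"
      if d: "premature d \<in> S \<kappa>" and "\<epsilon>\<^sub>0 \<kappa> \<le> \<epsilon> \<kappa>" for \<epsilon> \<kappa>
    proof -
      define a where "a = (1 + real (N \<kappa>) * R / total_stake) * x_max"
      have a: "0 < a" "a * total_stake = (total_stake + real (N \<kappa>) * R) * x_max"
        using constants x by (auto simp: a_def field_simps add_pos_nonneg)
      have "1 * (real (N \<kappa>) * R) \<le> ?n * (real (N \<kappa>) * R)"
        using constants by (intro mult_right_mono) (auto simp: Suc_le_eq)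
      then have "(total_stake + real (N \<kappa>) * R) * x * (?n * \<delta> \<kappa>)
          \<le> (total_stake + ?n * (real (N \<kappa>) * R)) * x * (?n * \<delta> \<kappa>)"
        using x \<delta>_nonneg[of \<kappa>] by (intro mult_right_mono) auto
      then have eq: "nash_equilibrium (S \<kappa>) (U \<kappa>) (\<epsilon> \<kappa>) (\<lambda>P. premature d)"
        using that(2) constants(5)
        by (intro L.equilibrium_premature[OF d q \<mu>]) (simp add: \<epsilon>\<^sub>0_def N b_def sole_def)
      have "welfare (U \<kappa>) (\<lambda>P. premature d) \<le> total_stake * x_min + \<epsilon>\<^sub>0 \<kappa>"
        using L.welfare_premature[OF d q \<mu>] constants(5) by (simp add: \<epsilon>\<^sub>0_def N b_def sole_def)
      also have "\<dots> = (x_min + \<nu> \<kappa>) * total_stake"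
        using constants by (simp add: \<nu>_def field_simps)
      finally have w: "welfare (U \<kappa>) (\<lambda>P. premature d) \<le> (x_min + \<nu> \<kappa>) * total_stake" .
      \<comment> \<open>If the denominator vanishes, both quotients are \<infinity>, as
        \<open>a\<close> is positive.\<close>
      have "ereal a / ereal (x_min + \<nu> \<kappa>) = ereal (a * total_stake) / ereal ((x_min + \<nu> \<kappa>) * total_stake)"
        using constants a(1) by (cases "x_min + \<nu> \<kappa> = 0") (simp_all add: divide_ereal_def)
      also have "\<dots> \<le> price_of_anarchy (S \<kappa>) (U \<kappa>) (\<epsilon> \<kappa>)"
        using constants a honest[of \<kappa>] eq w L.welfare_nonneg
        by (intro price_of_anarchy_ge[OF L.honest_profile_in]) simp_all
      finally show ?thesis by (simp add: a_def)
    qed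
    have "\<forall>\<^sub>F \<kappa> in sequentially.
         ereal ((1 + real (N \<kappa>) * R / total_stake) * x_max) / ereal (x_min + \<nu> \<kappa>)
         \<le> price_of_anarchy (S \<kappa>) (U \<kappa>) (\<epsilon> \<kappa>)" if "\<forall>\<kappa>. \<epsilon>\<^sub>0 \<kappa> \<le> \<epsilon> \<kappa>" for \<epsilon>
      by (rule eventually_mono[OF premature]) (rule bound, assumption, rule that[rule_format])
    then show "\<exists>\<epsilon>\<^sub>0 \<nu>. negl \<epsilon>\<^sub>0 \<and> negl \<nu> \<and> (\<forall>\<kappa>. \<nu> \<kappa> \<ge> 0) \<and>
       (\<forall>\<epsilon>. negl \<epsilon> \<and> (\<forall>\<kappa>. \<epsilon> \<kappa> \<ge> \<epsilon>\<^sub>0 \<kappa>) \<longrightarrow>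
          (\<forall>\<^sub>F \<kappa> in sequentially.
             ereal ((1 + real (N \<kappa>) * R / total_stake) * x_max) / ereal (x_min + \<nu> \<kappa>)
             \<le> price_of_anarchy (S \<kappa>) (U \<kappa>) (\<epsilon> \<kappa>)))"
      using negl_\<epsilon>\<^sub>0 negl_\<nu> \<nu> by blast
  qed
qed

end
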